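(* Let $T>0$. For every initial condition $\rho_0\in\mathcal{M}^{+}([0,1))$ and every boundary condition $\mu\in\mathcal{M}^{+}((0,T])$ with zero singular continuous parts, the measure-valued weak solution with initial condition $\rho_0$ and boundary condition $\mu$ is unique: if $\rho,\hat\rho\colon[0,T]\to\mathcal{M}^{+}([0,1))$ are both such weak solutions, then $\rho_t=\hat\rho_t$ for every $t\in[0,T]$.
   Context: For an interval $I\subseteq\mathbb{R}$, $\mathcal{M}^{+}(I)$ denotes the set of nonnegative finite Borel measures on $I$. The velocity $\alpha\colon[0,\infty)\to(0,1]$ is a fixed strictly decreasing, Lipschitz continuous function with $\alpha(0)=1$. Test functions: $\Psi$ is the set of functions $\varphi\colon[0,T]\times[0,1]\to\mathbb{R}$ such that for every $t\in[0,T]$, $\varphi(t,1)=0$ and $\varphi(t,\cdot)$ is differentiable; $\partial_x\varphi$ is continuous jointly in $(t,x)$; and for every $x\in[0,1)$, $\varphi(\cdot,x)$ is Lipschitz continuous. Weak solution: a function $\rho\colon[0,T]\to\mathcal{M}^{+}([0,1))$ is a measure-valued weak solution (of the conservation law $\partial_t\rho+\partial_x(\alpha(W(t))\rho)=0$) with initial condition $\rho_0$ and boundary condition $\mu$ if $W\colon t\mapsto\rho_t([0,1))$ is integrable on $[0,T]$ and for every $\tau\in[0,T]$ and every $\varphi\in\Psi$ $$0=\int_{(0,\tau]}\int_{[0,1)}\bigl(\partial_t\varphi(t,x)+\alpha(W(t))\,\partial_x\varphi(t,x)\bigr)\,d\rho_t(x)\,dt+\int_{(0,\tau]}\varphi(t,0)\,d\mu(t)-\int_{[0,1)}\varphi(\tau,x)\,d\rho_\tau(x)+\int_{[0,1)}\varphi(0,x)\,d\rho_0(x).$$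 *)

theory Defs
  imports "HOL-Analysis.Analysis"
begin

definition finite_borel_measures :: "real set \<Rightarrow> real measure set" where
  "finite_borel_measures I =
    {\<nu>. sets \<nu> = sets (restrict_space borel I) \<and> finite_measure \<nu>}"

(* The Lebesgue decomposition of nu on I into its absolutely continuous, singular
   continuous and pure point (atomic) parts. The three parts are uniquely determined by nu. *)
definition lebesgue_decomposition ::
    "real set \<Rightarrow> real measure \<Rightarrow> real measure \<Rightarrow> real measure \<Rightarrow> real measure \<Rightarrow> bool" where
  "lebesgue_decomposition I \<nu> \<nu>ac \<nu>sc \<nu>pp \<longleftrightarrow>
     \<nu>ac \<in> finite_borel_measures I \<and>
     \<nu>sc \<in> finite_borel_measures I \<and>
     \<nu>pp \<in> finite_borel_measures I \<and>
     absolutely_continuous (restrict_space lborel I) \<nu>ac \<and>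
     (\<exists>N \<in> null_sets (restrict_space lborel I). emeasure \<nu>sc (I - N) = 0) \<and>
     (\<forall>x\<in>I. emeasure \<nu>sc {x} = 0) \<and>
     (\<exists>C\<subseteq>I. countable C \<and> emeasure \<nu>pp (I - C) = 0) \<and>
     (\<forall>A \<in> sets \<nu>. emeasure \<nu> A = emeasure \<nu>ac A + emeasure \<nu>sc A + emeasure \<nu>pp A)"

definition zero_singular_continuous_part :: "real set \<Rightarrow> real measure \<Rightarrow> bool" where
  "zero_singular_continuous_part I \<nu> \<longleftrightarrow>
     (\<exists>\<nu>ac \<nu>pp. lebesgue_decomposition I \<nu> \<nu>ac (null_measure \<nu>) \<nu>pp)"

(* Both partial derivatives are taken within the domain [0,T] x [0,1], hence one-sided at its
   boundary; values of a test function outside the domain are irrelevant. *)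
definition partial_t :: "real \<Rightarrow> (real \<Rightarrow> real \<Rightarrow> real) \<Rightarrow> real \<Rightarrow> real \<Rightarrow> real" where
  "partial_t T \<phi> t x = vector_derivative (\<lambda>s. \<phi> s x) (at t within {0..T})"

definition partial_x :: "(real \<Rightarrow> real \<Rightarrow> real) \<Rightarrow> real \<Rightarrow> real \<Rightarrow> real" where
  "partial_x \<phi> t x = vector_derivative (\<phi> t) (at x within {0..1})"

definition test_functions :: "real \<Rightarrow> (real \<Rightarrow> real \<Rightarrow> real) set" where
  "test_functions T =
    {\<phi>. (\<forall>t\<in>{0..T}. \<phi> t 1 = 0 \<and> \<phi> t differentiable_on {0..1}) \<and>
        continuous_on ({0..T} \<times> {0..1}) (\<lambda>(t, x). partial_x \<phi> t x) \<and>
        (\<forall>x\<in>{0..<1}. \<exists>L. L-lipschitz_on {0..T} (\<lambda>t. \<phi> t x))}"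

definition mass :: "(real \<Rightarrow> real measure) \<Rightarrow> real \<Rightarrow> real" where
  "mass \<rho> t = measure (\<rho> t) {0..<1}"

(* For a fixed x the Lipschitz condition gives partial_t only at almost every t, and the Lipschitz
   constant may depend on x without being bounded. So partial_t of a test function need not be
   absolutely integrable against rho_t(dx) dt; this predicate says that it exists almost
   everywhere on (0,tau] x [0,1) with respect to rho_t(dx) dt and is absolutely integrable. *)
definition partial_t_integrable ::
    "real \<Rightarrow> (real \<Rightarrow> real measure) \<Rightarrow> real \<Rightarrow> (real \<Rightarrow> real \<Rightarrow> real) \<Rightarrow> bool" where
  "partial_t_integrable T \<rho> \<tau> \<phi> \<longleftrightarrow>
     (AE t in lebesgue_on {0<..\<tau>}.
        (AE x in \<rho> t. (\<lambda>s. \<phi> s x) differentiable (at t within {0..T})) \<and>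
        integrable (\<rho> t) (partial_t T \<phi> t)) \<and>
     set_integrable lebesgue {0<..\<tau>} (\<lambda>t. LINT x|\<rho> t. \<bar>partial_t T \<phi> t x\<bar>)"

(* The weak formulation is demanded for every test function for which its first integral is
   meaningful (see partial_t_integrable; the partial_x term is bounded in x and t). Without this
   proviso even a single moving point mass would fail to be a solution, on account of test
   functions whose partial_t is not integrable along its path. That the outer integrand is
   integrable, which includes its measurability in t, is part of the requirement. *)
definition weak_solution ::
    "real \<Rightarrow> (real \<Rightarrow> real) \<Rightarrow> real measure \<Rightarrow> real measure \<Rightarrow> (real \<Rightarrow> real measure) \<Rightarrow> bool" where
  "weak_solution T \<alpha> \<rho>0 \<mu> \<rho> \<longleftrightarrow>
     (\<forall>t\<in>{0..T}. \<rho> t \<in> finite_borel_measures {0..<1}) \<and>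
     set_integrable lebesgue {0..T} (mass \<rho>) \<and>
     (\<forall>\<tau>\<in>{0..T}. \<forall>\<phi>\<in>test_functions T. partial_t_integrable T \<rho> \<tau> \<phi> \<longrightarrow>
        set_integrable lebesgue {0<..\<tau>}
          (\<lambda>t. LINT x|\<rho> t. partial_t T \<phi> t x + \<alpha> (mass \<rho> t) * partial_x \<phi> t x) \<and>
        0 = (LINT t:{0<..\<tau>}|lebesgue.
               (LINT x|\<rho> t. partial_t T \<phi> t x + \<alpha> (mass \<rho> t) * partial_x \<phi> t x))
            + (LINT t:{0<..\<tau>}|\<mu>. \<phi> t 0)
            - (LINT x|\<rho> \<tau>. \<phi> \<tau> x)
            + (LINT x|\<rho>0. \<phi> 0 x))"

end

theory Submission
  imports Defs
begin

text \<open>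
  All the mass present moves with the same speed \<open>vel t = \<alpha> (mass \<rho> t)\<close>. Testing with functions
  that are constant along the characteristics shows that \<open>\<rho> \<tau>\<close> is the restriction to \<open>[0,1)\<close> of
  \<open>\<rho>0\<close> translated by \<open>pos \<tau> = \<integral> vel\<close>, plus the image of \<open>\<mu>\<close> under \<open>t \<mapsto> pos \<tau> - pos t\<close>. Hence two
  solutions with the same \<open>pos\<close> coincide. Suppose that the positions \<open>X\<close> and \<open>Y\<close> of two solutions
  agree up to time \<open>p\<close>. Shortly after \<open>p\<close> the two masses differ at most by the mass of those particles
  whose exit position lies between \<open>X\<close> and \<open>Y\<close>. Both curves increase at a speed bounded below by some
  \<open>c > 0\<close>, so if \<open>D\<close> is the largest distance between them on \<open>[p,p+h]\<close>, each exit position lies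
  between them during a time at most \<open>2 D / c\<close>. Integrating, \<open>D \<le> L (2 D / c) \<kappa>\<close>, where \<open>\<kappa>\<close> is the mass with
  exit position in \<open>(X p, X p + h]\<close>. This interval is open on the left, so \<open>\<kappa>\<close> tends to \<open>0\<close> with \<open>h\<close>,
  whence \<open>D = 0\<close> for small \<open>h\<close>.
\<close>

section \<open>Finite Borel measures on an interval\<close>

lemma finite_borel_measuresD:
  assumes "\<nu> \<in> finite_borel_measures I"
  shows "finite_measure \<nu>" "sets \<nu> = sets (restrict_space borel I)" "space \<nu> = I"
proof -
  show *: "finite_measure \<nu>" "sets \<nu> = sets (restrict_space borel I)"
    using assms by (auto simp: finite_borel_measures_def)
  show "space \<nu> = I"
    using sets_eq_imp_space_eq[OF *(2)] by (simp add: space_restrict_space)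
qed

lemma finite_borel_measures_setsI:
  assumes "\<nu> \<in> finite_borel_measures I" "A \<in> sets borel" "A \<subseteq> I"
  shows "A \<in> sets \<nu>"
proof -
  have "A = I \<inter> A" using assms(3) by auto
  then show ?thesis
    unfolding finite_borel_measuresD(2)[OF assms(1)] sets_restrict_space using assms(2) by auto
qed

lemma finite_borel_measures_measurable:
  assumes "\<nu> \<in> finite_borel_measures I" "f \<in> borel_measurable borel"
  shows "f \<in> borel_measurable \<nu>"
  using measurable_restrict_space1[OF assms(2)]
    measurable_cong_sets[OF finite_borel_measuresD(2)[OF assms(1)] refl] by blast

lemma finite_borel_measures_measurable_continuous_on:
  fixes f :: "real \<Rightarrow> real"
  assumes "\<nu> \<in> finite_borel_measures I" "continuous_on J f" "I \<subseteq> J"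
  shows "f \<in> borel_measurable \<nu>"
  using borel_measurable_continuous_on_restrict[OF continuous_on_subset[OF assms(2,3)]]
    measurable_cong_sets[OF finite_borel_measuresD(2)[OF assms(1)] refl]
  by blast

text \<open>Reflection at 0 turns the initial segments \<open>{a..<c}\<close> into the upper rays on
  which \<open>measure_eqI_lessThan\<close> compares two measures on the line. The two reflected
  measures therefore agree, and reflecting back gives the claim.\<close>

lemma finite_borel_measures_eqI:
  assumes M: "M \<in> finite_borel_measures {a..<b}" and N: "N \<in> finite_borel_measures {a..<b}"
    and eq: "\<And>c. c \<le> b \<Longrightarrow> measure M {a..<c} = measure N {a..<c}"
  shows "M = N"
proof (rule measure_eqI)
  interpret M: finite_measure M using finite_borel_measuresD(1)[OF M] .
  interpret N: finite_measure N using finite_borel_measuresD(1)[OF N] .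
  note sets_M = finite_borel_measuresD(2)[OF M] and sets_N = finite_borel_measuresD(2)[OF N]
  note space_M = finite_borel_measuresD(3)[OF M] and space_N = finite_borel_measuresD(3)[OF N]
  show "sets M = sets N" unfolding sets_M sets_N ..
  have meas: "uminus \<in> borel_measurable M" "uminus \<in> borel_measurable N"
    by (rule finite_borel_measures_measurable[OF M] finite_borel_measures_measurable[OF N], simp)+
  have "distr M borel uminus = distr N borel uminus"
  proof (rule measure_eqI_lessThan)
    fix x :: real
    have tail: "uminus -` {x<..} \<inter> {a..<b} = {a..<min b (-x)}" by auto
    have "emeasure (distr M borel uminus) {x<..} = measure M {a..<min b (-x)}"
      using emeasure_distr[OF meas(1), of "{x<..}"] M.emeasure_eq_measure
      unfolding space_M tail by simp
    moreover have "emeasure (distr N borel uminus) {x<..} = measure N {a..<min b (-x)}"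
      using emeasure_distr[OF meas(2), of "{x<..}"] N.emeasure_eq_measure
      unfolding space_N tail by simp
    ultimately show "emeasure (distr M borel uminus) {x<..} = emeasure (distr N borel uminus) {x<..}"
      and "emeasure (distr M borel uminus) {x<..} < \<infinity>"
      using eq[of "min b (-x)"] by simp_all
  qed simp_all
  then have distr_eq: "emeasure M (uminus -` B \<inter> {a..<b}) = emeasure N (uminus -` B \<inter> {a..<b})"
    if "B \<in> sets borel" for B
    using emeasure_distr[OF meas(1) that] emeasure_distr[OF meas(2) that]
    unfolding space_M space_N by metis
  fix A assume "A \<in> sets M"
  then have A: "A \<in> sets borel" "A \<subseteq> {a..<b}"
    unfolding sets_M by (auto simp: sets_restrict_space)
  \<comment> \<open>Reflection is an involution, so \<open>A\<close> is the preimage of its own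
    mirror image.\<close>
  have "uminus -` A \<in> sets borel"
    using A(1) by (rule measurable_sets_borel[rotated]) simp
  moreover have "uminus -` (uminus -` A) \<inter> {a..<b} = A" using A(2) by auto
  ultimately show "emeasure M A = emeasure N A"
    using distr_eq[of "uminus -` A"] by simp
qed

lemma (in finite_measure) measure_symmetric_difference_le:
  assumes "A \<in> sets M" "B \<in> sets M" "C \<in> sets M" "A - B \<subseteq> C" "B - A \<subseteq> C"
  shows "\<bar>measure M A - measure M B\<bar> \<le> measure M C"
proof -
  have "measure M U \<le> measure M V + measure M C" if "U \<in> sets M" "V \<in> sets M" "U - V \<subseteq> C" for U V
    by (rule order_trans[OF finite_measure_mono measure_Un_le])
      (use that assms(3) in auto)
  from this[of A B] this[of B A] show ?thesis using assms by (simp add: abs_le_iff)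
qed

section \<open>Test functions moving with a cutoff\<close>

lemma vector_derivative_within_Icc:
  fixes f :: "real \<Rightarrow> real"
  assumes "(f has_real_derivative d) (at x within {a..b})" "a < b" "x \<in> {a..b}"
  shows "vector_derivative f (at x within {a..b}) = d"
  using assms by (intro vector_derivative_within_closed_interval)
    (auto simp: has_real_derivative_iff_has_vector_derivative)

text \<open>Profiles from which test functions of the form \<open>\<psi> (x + S t)\<close> with
  \<open>S t \<ge> 0\<close> are built. Only nonnegative arguments then occur, which is why the
  derivative is bounded there only; vanishing from 1 on supplies the condition at
  \<open>x = 1\<close>.\<close>

locale cutoff =
  fixes \<psi> \<psi>' :: "real \<Rightarrow> real" and B :: real
  assumes deriv: "\<And>y. (\<psi> has_real_derivative \<psi>' y) (at y)"
    and cont_deriv: "continuous_on UNIV \<psi>'"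
    and deriv_bound: "\<And>y. 0 \<le> y \<Longrightarrow> \<bar>\<psi>' y\<bar> \<le> B"
    and vanish: "\<And>y. 1 \<le> y \<Longrightarrow> \<psi> y = 0"
begin

lemma bound_nonneg: "0 \<le> B"
  using deriv_bound[of 0] by simp

lemma lipschitz: "B-lipschitz_on {0..} \<psi>"
proof (rule bounded_derivative_imp_lipschitz)
  show "(\<psi> has_derivative (\<lambda>h. \<psi>' y * h)) (at y within {0..})" if "y \<in> {0..}" for y
    using deriv[of y] has_derivative_at_withinI unfolding has_field_derivative_def by blast
  show "onorm (\<lambda>h. \<psi>' y * h) \<le> B" if "y \<in> {0..}" for y
    by (rule onorm_bound)
      (use that bound_nonneg deriv_bound[of y] in \<open>auto simp: abs_mult intro: mult_right_mono\<close>)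
qed (use bound_nonneg in auto)

lemma cont: "continuous_on UNIV \<psi>"
  using deriv by (meson DERIV_isCont continuous_at_imp_continuous_on)

lemma bounded_nonneg: "\<exists>C. \<forall>y\<ge>0. \<bar>\<psi> y\<bar> \<le> C"
proof -
  have "\<bar>\<psi> y\<bar> \<le> B" if "0 \<le> y" for y
  proof (cases "1 \<le> y")
    case True then show ?thesis using vanish bound_nonneg by simp
  next
    case False
    have "dist (\<psi> y) (\<psi> 1) \<le> B * dist y 1"
      by (rule lipschitz_onD[OF lipschitz]) (use that in auto)
    also have "\<dots> \<le> B * 1" using False that bound_nonneg by (intro mult_left_mono) (auto simp: dist_real_def)
    finally show ?thesis using vanish by (simp add: dist_real_def)
  qed
  then show ?thesis by blast
qed

lemma partial_x_shift:
  assumes "x \<in> {0..1}"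
  shows "partial_x (\<lambda>t x. \<psi> (x + S t)) t x = \<psi>' (x + S t)"
  unfolding partial_x_def
proof (rule vector_derivative_within_Icc)
  have "((\<lambda>x. x + S t) has_real_derivative 1) (at x within {0..1})"
    by (auto intro!: derivative_eq_intros)
  then show "((\<lambda>x. \<psi> (x + S t)) has_real_derivative \<psi>' (x + S t)) (at x within {0..1})"
    using DERIV_chain2[OF deriv] by fastforce
qed (use assms in auto)

lemma shift_has_time_derivative:
  assumes "(S has_real_derivative s) (at t within {0..T})"
  shows "((\<lambda>t. \<psi> (x + S t)) has_real_derivative \<psi>' (x + S t) * s) (at t within {0..T})"
  by (rule DERIV_chain2[OF deriv]) (use assms in \<open>auto intro!: derivative_eq_intros\<close>)

lemma partial_t_shift:
  assumes "0 < T" "t \<in> {0..T}" "(S has_real_derivative s) (at t within {0..T})"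
  shows "partial_t T (\<lambda>t x. \<psi> (x + S t)) t x = \<psi>' (x + S t) * s"
  unfolding partial_t_def
  by (rule vector_derivative_within_Icc[OF shift_has_time_derivative]) (use assms in auto)

text \<open>Nonnegativity of \<open>S\<close> acts twice: \<open>1 + S t\<close> lies where
  \<open>\<psi>\<close> vanishes, and \<open>x + S t\<close> stays in the half-line where
  \<open>\<psi>\<close> is Lipschitz. In time, composing Lipschitz functions suffices, so
  \<open>S\<close> may have kinks.\<close>

lemma shift_test_function:
  assumes S: "L-lipschitz_on {0..T} S" "\<And>t. t \<in> {0..T} \<Longrightarrow> 0 \<le> S t"
  shows "(\<lambda>t x. \<psi> (x + S t)) \<in> test_functions T"
proof -
  have "(\<lambda>x. \<psi> (x + S t)) differentiable_on {0..1}" for t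
    unfolding differentiable_on_def
  proof
    fix x :: real
    have "((\<lambda>x. \<psi> (x + S t)) has_real_derivative \<psi>' (x + S t) * 1) (at x within {0..1})"
      by (rule DERIV_chain2[OF deriv]) (auto intro!: derivative_eq_intros)
    then show "(\<lambda>x. \<psi> (x + S t)) differentiable at x within {0..1}"
      using real_differentiable_def by blast
  qed
  moreover have "continuous_on ({0..T} \<times> {0..1}) (\<lambda>(t, x). partial_x (\<lambda>t x. \<psi> (x + S t)) t x)"
  proof -
    have "continuous_on ({0..T} \<times> {0..1}) (\<lambda>p. \<psi>' (snd p + S (fst p)))"
      by (intro continuous_intros continuous_on_compose2[OF cont_deriv]
          continuous_on_compose2[OF lipschitz_on_continuous_on[OF S(1)]]) auto
    then show ?thesis
      by (rule continuous_on_eq) (auto simp: partial_x_shift)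
  qed
  moreover have "\<exists>L. L-lipschitz_on {0..T} (\<lambda>t. \<psi> (x + S t))" if "0 \<le> x" for x
  proof -
    have "L-lipschitz_on {0..T} (\<lambda>t. x + S t)"
      using S(1) by (auto simp: lipschitz_on_def dist_real_def)
    moreover have "B-lipschitz_on ((\<lambda>t. x + S t) ` {0..T}) \<psi>"
      using lipschitz by (rule lipschitz_on_subset) (use S(2) that in auto)
    ultimately show ?thesis using lipschitz_on_compose2 by blast
  qed
  ultimately show ?thesis
    unfolding test_functions_def using S(2) vanish by (intro CollectI conjI ballI) auto
qed

end

section \<open>Integrals of a bounded speed up to a fixed final time\<close>

lemma tail_integral_lipschitz:
  fixes a :: "real \<Rightarrow> real"
  assumes int: "\<And>p q. a integrable_on {p..q}" and a: "\<And>t. 0 \<le> a t" "\<And>t. a t \<le> 1"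
  shows "1-lipschitz_on U (\<lambda>t. integral {t..\<tau>} a)"
proof -
  have bnd: "\<bar>integral {p..q} a\<bar> \<le> q - p" if "p \<le> q" for p q
    using integral_nonneg[OF int[of p q]] integral_le[OF int[of p q] integrable_const_ivl[of 1]] that a
    by (simp add: abs_le_iff)
  have le: "\<bar>integral {t..\<tau>} a - integral {s..\<tau>} a\<bar> \<le> s - t" if "t \<le> s" for s t
  proof (cases "s \<le> \<tau>")
    case True
    then have "integral {t..\<tau>} a = integral {t..s} a + integral {s..\<tau>} a"
      using Henstock_Kurzweil_Integration.integral_combine[OF that True int] by simp
    then show ?thesis using bnd[OF that] by simp
  next
    \<comment> \<open>Past \<open>\<tau>\<close> the interval of integration is empty and the
      integral is 0 by convention, so the Lipschitz bound extends to the whole line.\<close>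
    case False
    then have "integral {s..\<tau>} a = 0" by simp
    moreover have "\<bar>integral {t..\<tau>} a\<bar> \<le> s - t"
      using bnd[of t \<tau>] False that by (cases "t \<le> \<tau>") auto
    ultimately show ?thesis by simp
  qed
  show ?thesis
    unfolding lipschitz_on_def
  proof (intro conjI ballI)
    fix s t
    show "dist (integral {s..\<tau>} a) (integral {t..\<tau>} a) \<le> 1 * dist s t"
      using le[of s t] le[of t s] by (cases "s \<le> t") (auto simp: dist_real_def abs_minus_commute)
  qed simp
qed

text \<open>The strict inequality \<open>t < \<tau>\<close> avoids the possible kink at
  \<open>\<tau>\<close>, after which the integral stays 0. Before \<open>\<tau>\<close> the
  intervals \<open>{0..T}\<close> and \<open>{0..\<tau>}\<close> agree near
  \<open>t\<close>.\<close>

lemma tail_integral_has_derivative: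
  fixes a :: "real \<Rightarrow> real"
  assumes "continuous_on UNIV a" "0 \<le> t" "t < \<tau>" "\<tau> \<le> T"
  shows "((\<lambda>t. integral {t..\<tau>} a) has_real_derivative - a t) (at t within {0..T})"
proof -
  have "at t within {0..T} = at t within {0..\<tau>}"
    by (rule at_within_nhd[of _ "{..<\<tau>}"]) (use assms in auto)
  then show ?thesis
    using integral_has_real_derivative'[OF continuous_on_subset[OF assms(1)], of 0 \<tau> t] assms by simp
qed

lemma bounded_measurable_integrable_on:
  fixes f :: "real \<Rightarrow> real"
  assumes "f \<in> borel_measurable lebesgue" "\<And>t. \<bar>f t\<bar> \<le> C"
  shows "f integrable_on {p..q}"
proof (rule measurable_bounded_by_integrable_imp_integrable)
  show "f \<in> borel_measurable (lebesgue_on {p..q})"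
    using assms(1) by (rule measurable_restrict_space1)
  show "(\<lambda>t. C) integrable_on {p..q}" by (rule integrable_const_ivl)
qed (use assms in auto)

lemma tendsto_tail_integral:
  fixes a :: "nat \<Rightarrow> real \<Rightarrow> real"
  assumes int: "\<And>n. a n integrable_on {t..\<tau>}" and bnd: "\<And>n t. \<bar>a n t\<bar> \<le> C"
    and N: "negligible N" and lim: "\<And>t. t \<notin> N \<Longrightarrow> (\<lambda>n. a n t) \<longlonglongrightarrow> b t"
  shows "(\<lambda>n. integral {t..\<tau>} (a n)) \<longlonglongrightarrow> integral {t..\<tau>} b"
proof -
  \<comment> \<open>Dominated convergence is applied in a form that asks for convergence at every
    point, so all functions are set to 0 on the null set \<open>N\<close>; the integrals do not
    change.\<close>
  have "(\<lambda>n. integral {t..\<tau>} (\<lambda>s. if s \<in> N then 0 else a n s))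
      \<longlonglongrightarrow> integral {t..\<tau>} (\<lambda>s. if s \<in> N then 0 else b s)"
  proof (rule dominated_convergence(2))
    show "(\<lambda>s. if s \<in> N then 0 else a n s) integrable_on {t..\<tau>}" for n
      using int[of n] N by (rule integrable_spike) auto
    show "(\<lambda>s. C) integrable_on {t..\<tau>}" by (rule integrable_const_ivl)
    show "norm (if s \<in> N then 0 else a n s) \<le> C" for n s
      using order_trans[OF abs_ge_zero bnd] bnd by auto
    show "(\<lambda>n. if s \<in> N then 0 else a n s) \<longlonglongrightarrow> (if s \<in> N then 0 else b s)" for s
      using lim by auto
  qed
  moreover have "integral {t..\<tau>} (\<lambda>s. if s \<in> N then 0 else f s) = integral {t..\<tau>} f" for f :: "real \<Rightarrow> real"
    using N by (rule integral_spike) auto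
  ultimately show ?thesis by simp
qed

section \<open>The solution as a transported measure\<close>

locale transport =
  fixes T :: real and \<alpha> :: "real \<Rightarrow> real" and \<rho>0 \<mu> :: "real measure"
    and \<rho> :: "real \<Rightarrow> real measure"
  assumes T_pos: "T > 0"
    and alpha_range: "\<alpha> \<in> {0..} \<rightarrow> {0<..1}"
    and alpha_cont: "continuous_on {0..} \<alpha>"
    and initial: "\<rho>0 \<in> finite_borel_measures {0..<1}"
    and boundary: "\<mu> \<in> finite_borel_measures {0<..T}"
    and solution: "weak_solution T \<alpha> \<rho>0 \<mu> \<rho>"
begin

lemma rho: "t \<in> {0..T} \<Longrightarrow> \<rho> t \<in> finite_borel_measures {0..<1}"
  and mass_integrable: "set_integrable lebesgue {0..T} (mass \<rho>)"
  using solution by (auto simp: weak_solution_def)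

lemma mass_nonneg: "0 \<le> mass \<rho> t"
  by (simp add: mass_def)

lemma rho_integrable:
  fixes g :: "real \<Rightarrow> real"
  assumes "t \<in> {0..T}" "continuous_on {0..1} g"
  shows "integrable (\<rho> t) g"
proof -
  obtain C where "\<forall>y\<in>g ` {0..1}. norm y \<le> C"
    using compact_imp_bounded[OF compact_continuous_image[OF assms(2) compact_Icc]]
    by (auto simp: bounded_iff)
  then have C: "\<bar>g x\<bar> \<le> C" if "x \<in> {0..1}" for x using that by auto
  interpret finite_measure "\<rho> t" using finite_borel_measuresD(1)[OF rho[OF assms(1)]] .
  show ?thesis
  proof (rule integrable_const_bound)
    show "AE x in \<rho> t. norm (g x) \<le> C"
      using C finite_borel_measuresD(3)[OF rho[OF assms(1)]] by (intro AE_I2) auto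
    show "g \<in> borel_measurable (\<rho> t)"
      by (rule finite_borel_measures_measurable_continuous_on[OF rho[OF assms(1)] assms(2)]) auto
  qed
qed

lemma rho_integral_bound:
  fixes g :: "real \<Rightarrow> real"
  assumes "t \<in> {0..T}" "\<And>x. x \<in> {0..<1} \<Longrightarrow> \<bar>g x\<bar> \<le> C" "0 \<le> C"
  shows "\<bar>LINT x|\<rho> t. g x\<bar> \<le> C * mass \<rho> t"
proof -
  note space = finite_borel_measuresD(3)[OF rho[OF assms(1)]]
  interpret finite_measure "\<rho> t" using finite_borel_measuresD(1)[OF rho[OF assms(1)]] .
  show ?thesis
  proof (cases "integrable (\<rho> t) g")
    case True
    have "\<bar>LINT x|\<rho> t. g x\<bar> \<le> (LINT x|\<rho> t. C)"
      by (rule integral_abs_bound[THEN order_trans], rule integral_mono)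
        (use True assms(2) space in auto)
    then show ?thesis using space by (simp add: mass_def mult.commute)
  next
    \<comment> \<open>A non-integrable function has integral 0 by convention, so the bound
      persists.\<close>
    case False
    then show ?thesis using assms(3) mass_nonneg by (simp add: not_integrable_integral_eq)
  qed
qed

text \<open>The indicator replaces the mass by 0 outside \<open>{0..T}\<close>. This makes
  \<open>vel\<close> Lebesgue measurable on the whole line, with values in \<open>{0<..1}\<close>
  everywhere.\<close>

definition vel :: "real \<Rightarrow> real" where
  "vel t = \<alpha> (indicator {0..T} t * mass \<rho> t)"

lemma vel_eq: "t \<in> {0..T} \<Longrightarrow> vel t = \<alpha> (mass \<rho> t)"
  by (simp add: vel_def)

lemma vel_pos: "0 < vel t" and vel_le_1: "vel t \<le> 1"
proof -
  have "0 \<le> indicator {0..T} t * mass \<rho> t" by (simp add: mass_nonneg)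
  then show "0 < vel t" "vel t \<le> 1" using alpha_range by (auto simp: vel_def Pi_iff)
qed

lemma vel_measurable: "vel \<in> borel_measurable lebesgue"
proof -
  \<comment> \<open>Taking \<open>max 0 y\<close> as argument extends \<open>\<alpha>\<close>
    continuously to the line without changing it at masses, which are nonnegative.\<close>
  have "continuous_on UNIV (\<lambda>y. \<alpha> (max 0 y))"
    by (rule continuous_on_compose2[OF alpha_cont]) (auto intro!: continuous_intros)
  moreover have "(\<lambda>t. indicator {0..T} t * mass \<rho> t) \<in> borel_measurable lebesgue"
    using mass_integrable unfolding set_integrable_def by (auto dest: borel_measurable_integrable)
  ultimately have "(\<lambda>t. \<alpha> (max 0 (indicator {0..T} t * mass \<rho> t))) \<in> borel_measurable lebesgue"
    by (rule borel_measurable_continuous_on)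
  then show ?thesis by (simp add: vel_def[abs_def] max_def mass_nonneg)
qed

lemma vel_integrable_on: "vel integrable_on {p..q}"
  by (rule bounded_measurable_integrable_on[OF vel_measurable, of 1])
    (use vel_pos vel_le_1 in \<open>auto simp: abs_le_iff less_imp_le intro: order_trans[of _ 0]\<close>)

lemma vel_tail_continuous: "continuous_on U (\<lambda>t. integral {t..\<tau>} vel)"
  by (intro lipschitz_on_continuous_on[OF tail_integral_lipschitz] vel_integrable_on vel_le_1
      less_imp_le[OF vel_pos])

text \<open>The antiderivative of \<open>g\<close> is normalised to vanish at 1. In the weak
  formulation its time derivative drops out, and the inner integral becomes the speed times the
  moment of \<open>g\<close>.\<close>

lemma time_independent_test_function:
  fixes g :: "real \<Rightarrow> real"
  assumes g: "continuous_on {0..1} g"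
  defines "\<phi> \<equiv> \<lambda>(t::real) x. integral {0..x} g - integral {0..1} g"
  shows "\<phi> \<in> test_functions T" "\<And>t x. x \<in> {0..1} \<Longrightarrow> partial_x \<phi> t x = g x"
    "\<And>t x. t \<in> {0..T} \<Longrightarrow> partial_t T \<phi> t x = 0"
proof -
  have deriv: "(\<phi> t has_real_derivative g x) (at x within {0..1})" if "x \<in> {0..1}" for t x
    unfolding \<phi>_def using integral_has_real_derivative[OF g that]
    by (auto intro!: derivative_eq_intros)
  show partial_x: "partial_x \<phi> t x = g x" if "x \<in> {0..1}" for t x
    unfolding partial_x_def by (rule vector_derivative_within_Icc[OF deriv]) (use that in auto)
  show "partial_t T \<phi> t x = 0" if "t \<in> {0..T}" for t x
    unfolding partial_t_def \<phi>_def by (rule vector_derivative_within_Icc) (use that T_pos in auto)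
  have "continuous_on ({0..T} \<times> {0..1}) (\<lambda>(t, x). partial_x \<phi> t x)"
  proof (rule continuous_on_eq)
    show "continuous_on ({0..T} \<times> {0..1}) (\<lambda>p::real \<times> real. g (snd p))"
      by (rule continuous_on_compose2[OF g]) (auto intro!: continuous_intros)
  qed (auto simp: partial_x)
  moreover have "\<phi> t differentiable_on {0..1}" for t
    using deriv[of _ t] unfolding differentiable_on_def real_differentiable_def by blast
  moreover have "\<exists>L. L-lipschitz_on {0..T} (\<lambda>t. \<phi> t x)" for x
    unfolding \<phi>_def by (intro exI[of _ 0] lipschitz_on_constant)
  moreover have "\<phi> t 1 = 0" for t by (simp add: \<phi>_def)
  ultimately show "\<phi> \<in> test_functions T"
    unfolding test_functions_def by (intro CollectI conjI ballI)
qed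

text \<open>Joint measurability of the solution in time is not part of the hypotheses; it comes from
  inserting the antiderivative of \<open>g\<close> as a time-independent test function.\<close>

lemma moment_measurable:
  fixes g :: "real \<Rightarrow> real"
  assumes g: "continuous_on {0..1} g"
  shows "(\<lambda>t. LINT x|\<rho> t. g x) \<in> borel_measurable (lebesgue_on {0<..T})"
proof -
  define \<phi> where "\<phi> = (\<lambda>(t::real) x. integral {0..x} g - integral {0..1} g :: real)"
  note test = time_independent_test_function[OF g, folded \<phi>_def]
  have int0: "integrable (\<rho> t) (partial_t T \<phi> t)" if "t \<in> {0..T}" for t
  proof -
    have "partial_t T \<phi> t = (\<lambda>x. 0)" using test(3) that by auto
    then show ?thesis by simp
  qed
  have "partial_t_integrable T \<rho> T \<phi>"
    unfolding partial_t_integrable_def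
  proof (intro conjI)
    show "AE t in lebesgue_on {0<..T}.
        (AE x in \<rho> t. (\<lambda>s. \<phi> s x) differentiable (at t within {0..T})) \<and>
        integrable (\<rho> t) (partial_t T \<phi> t)"
    proof (rule AE_I2)
      fix t assume "t \<in> space (lebesgue_on {0<..T})"
      then have "t \<in> {0..T}" by auto
      then show "(AE x in \<rho> t. (\<lambda>s. \<phi> s x) differentiable (at t within {0..T})) \<and>
        integrable (\<rho> t) (partial_t T \<phi> t)"
        using int0 by (simp add: \<phi>_def)
    qed
    have "set_integrable lebesgue {0<..T} (\<lambda>t. 0 :: real)" by (simp add: set_integrable_def)
    then show "set_integrable lebesgue {0<..T} (\<lambda>t. LINT x|\<rho> t. \<bar>partial_t T \<phi> t x\<bar>)"
      by (rule set_integrable_cong[THEN iffD1, rotated -1]) (auto simp: test(3))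
  qed
  then have "set_integrable lebesgue {0<..T}
      (\<lambda>t. LINT x|\<rho> t. partial_t T \<phi> t x + \<alpha> (mass \<rho> t) * partial_x \<phi> t x)"
    using solution test(1) T_pos unfolding weak_solution_def by auto
  then have "integrable (lebesgue_on {0<..T})
      (\<lambda>t. LINT x|\<rho> t. partial_t T \<phi> t x + \<alpha> (mass \<rho> t) * partial_x \<phi> t x)"
    by (simp add: set_integrable_def integrable_restrict_space)
  \<comment> \<open>The integrand is \<open>vel t\<close> times the moment of \<open>g\<close>;
    since the speed is positive, division recovers the moment and keeps measurability.\<close>
  then have "(\<lambda>t. (LINT x|\<rho> t. partial_t T \<phi> t x + \<alpha> (mass \<rho> t) * partial_x \<phi> t x) / vel t)
      \<in> borel_measurable (lebesgue_on {0<..T})"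
    by (intro borel_measurable_divide measurable_restrict_space1[OF vel_measurable]
        borel_measurable_integrable)
  moreover have "(LINT x|\<rho> t. partial_t T \<phi> t x + \<alpha> (mass \<rho> t) * partial_x \<phi> t x) / vel t
      = (LINT x|\<rho> t. g x)" if "t \<in> space (lebesgue_on {0<..T})" for t
  proof -
    have t: "t \<in> {0..T}" using that by auto
    have "(LINT x|\<rho> t. partial_t T \<phi> t x + \<alpha> (mass \<rho> t) * partial_x \<phi> t x)
        = (LINT x|\<rho> t. vel t * g x)"
      by (rule Bochner_Integration.integral_cong)
        (use t test(2,3) finite_borel_measuresD(3)[OF rho[OF t]] in \<open>auto simp: vel_eq\<close>)
    then show ?thesis using vel_pos[of t] by simp
  qed
  ultimately show ?thesis by (rule measurable_cong[THEN iffD1, rotated]) 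
qed

text \<open>Rounding the time argument of \<open>G\<close> down to multiples of \<open>1 / n\<close>
  leaves countably many moments of fixed functions, each measurable by
  \<open>moment_measurable\<close>. As \<open>n\<close> grows they converge by continuity of
  \<open>G\<close>, with a constant as dominating function.\<close>

lemma parametric_moment_measurable:
  fixes G :: "real \<Rightarrow> real \<Rightarrow> real"
  assumes G: "continuous_on ({0..T} \<times> {0..1}) (\<lambda>p. G (fst p) (snd p))"
  shows "(\<lambda>t. LINT x|\<rho> t. G t x) \<in> borel_measurable (lebesgue_on {0<..T})"
proof (rule borel_measurable_LIMSEQ_real)
  \<comment> \<open>\<open>measurable_compose_countable\<close> ranges over all integers, so every
    grid point has to be clamped to \<open>{0..T}\<close>, including those that rounding never
    produces.\<close>
  define c where "c = (\<lambda>s. max 0 (min T s))"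
  define d where "d = (\<lambda>(n::nat) t. c (real_of_int \<lfloor>real n * t\<rfloor> / real n))"
  have c: "c s \<in> {0..T}" for s using T_pos by (auto simp: c_def)
  have d: "d n t \<in> {0..T}" for n t using c by (auto simp: d_def)
  have G2: "continuous_on {0..1} (G s)" if "s \<in> {0..T}" for s
    by (rule continuous_on_compose2[OF G, of _ "\<lambda>x. (s, x)", simplified])
      (use that in \<open>auto intro!: continuous_intros\<close>)
  have G1: "continuous_on {0..T} (\<lambda>s. G s x)" if "x \<in> {0..1}" for x
    by (rule continuous_on_compose2[OF G, of _ "\<lambda>s. (s, x)", simplified])
      (use that in \<open>auto intro!: continuous_intros\<close>)
  obtain C where C: "\<And>s x. s \<in> {0..T} \<Longrightarrow> x \<in> {0..1} \<Longrightarrow> \<bar>G s x\<bar> \<le> C"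
    using compact_imp_bounded[OF compact_continuous_image[OF G compact_Times[OF compact_Icc compact_Icc]]]
    by (force simp: bounded_iff)
  show "(\<lambda>t. LINT x|\<rho> t. G (d n t) x) \<in> borel_measurable (lebesgue_on {0<..T})" for n
  proof -
    have "(\<lambda>t. \<lfloor>real n * t\<rfloor>) \<in> measurable lborel (count_space UNIV)"
      by measurable
    then have "(\<lambda>t. \<lfloor>real n * t\<rfloor>) \<in> measurable lebesgue (count_space UNIV)"
      by (rule measurable_completion)
    then have fl: "(\<lambda>t. \<lfloor>real n * t\<rfloor>) \<in> measurable (lebesgue_on {0<..T}) (count_space UNIV)"
      by (rule measurable_restrict_space1)
    show ?thesis
      unfolding d_def
      by (rule measurable_compose_countable[OF moment_measurable[OF G2[OF c]] fl])
  qed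
  show "(\<lambda>n. LINT x|\<rho> t. G (d n t) x) \<longlonglongrightarrow> (LINT x|\<rho> t. G t x)"
    if "t \<in> space (lebesgue_on {0<..T})" for t
  proof (rule integral_dominated_convergence)
    have t: "t \<in> {0..T}" using that by auto
    note space = finite_borel_measuresD(3)[OF rho[OF t]]
    show "G t \<in> borel_measurable (\<rho> t)" "\<And>n. G (d n t) \<in> borel_measurable (\<rho> t)"
      using rho_integrable[OF t G2[OF t]] rho_integrable[OF t G2[OF d]] by auto
    show "integrable (\<rho> t) (\<lambda>x. C)" by (rule rho_integrable[OF t]) simp
    show "AE x in \<rho> t. norm (G (d n t) x) \<le> C" for n
      using C[OF d] space by (intro AE_I2) auto
    have "(\<lambda>n. d n t) \<longlonglongrightarrow> c t"
    proof -
      have "(\<lambda>n. real_of_int \<lfloor>real n * t\<rfloor> / real n) \<longlonglongrightarrow> t"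
      proof (rule tendsto_sandwich)
        show "\<forall>\<^sub>F n in sequentially. t - 1 / real n \<le> real_of_int \<lfloor>real n * t\<rfloor> / real n"
          using eventually_gt_at_top[of 0]
        proof eventually_elim
          case (elim n)
          have "(real n * t - 1) / real n \<le> real_of_int \<lfloor>real n * t\<rfloor> / real n"
            by (intro divide_right_mono) linarith+
          then show ?case using elim by (simp add: diff_divide_distrib)
        qed
        show "\<forall>\<^sub>F n in sequentially. real_of_int \<lfloor>real n * t\<rfloor> / real n \<le> t"
          using eventually_gt_at_top[of 0]
          by eventually_elim (simp add: field_simps)
        show "(\<lambda>n. t - 1 / real n) \<longlonglongrightarrow> t"
          using tendsto_diff[OF tendsto_const lim_1_over_n, of t] by simp
      qed simp
      then show ?thesis unfolding d_def c_def by (intro tendsto_intros)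
    qed
    moreover have "c t = t" using t by (auto simp: c_def)
    ultimately have "(\<lambda>n. d n t) \<longlonglongrightarrow> t" by simp
    then have "(\<lambda>n. G (d n t) x) \<longlonglongrightarrow> G t x" if "x \<in> {0..<1}" for x
      using G1[of x] that t d by (intro continuous_on_tendsto_compose[OF G1]) auto
    then show "AE x in \<rho> t. (\<lambda>n. G (d n t) x) \<longlonglongrightarrow> G t x"
      using space by (intro AE_I2) auto
  qed
qed

lemma mass_integrable_on:
  assumes "\<tau> \<in> {0..T}"
  shows "mass \<rho> absolutely_integrable_on {0<..\<tau>}"
  by (rule set_integrable_subset[OF mass_integrable]) (use assms in auto)

lemma AE_lebesgue_neq: "AE t in lebesgue. t \<noteq> (\<tau>::real)"
  by (intro AE_completion AE_lborel_singleton)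

text \<open>For \<open>a\<close> equal to \<open>vel\<close> the test function would be constant along characteristics and \<open>F\<close>
  would vanish; continuity of \<open>a\<close> is what makes its time derivative exist everywhere.\<close>

lemma approximate_transport:
  assumes "cutoff \<psi> \<psi>' B" and \<tau>: "\<tau> \<in> {0..T}"
    and a: "continuous_on UNIV a" "\<And>t. 0 \<le> a t" "\<And>t. a t \<le> 1"
  defines "S \<equiv> \<lambda>t. integral {t..\<tau>} a"
  obtains F where "set_integrable lebesgue {0<..\<tau>} F"
    and "\<And>t. t \<in> {0<..<\<tau>} \<Longrightarrow> \<bar>F t\<bar> \<le> \<bar>vel t - a t\<bar> * (B * mass \<rho> t)"
    and "0 = (LINT t:{0<..\<tau>}|lebesgue. F t) + (LINT t:{0<..\<tau>}|\<mu>. \<psi> (S t))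
      - (LINT x|\<rho> \<tau>. \<psi> x) + (LINT x|\<rho>0. \<psi> (x + S 0))"
proof -
  interpret cutoff \<psi> \<psi>' B by fact
  define \<phi> where "\<phi> = (\<lambda>t x. \<psi> (x + S t))"
  define F where "F = (\<lambda>t. LINT x|\<rho> t. partial_t T \<phi> t x + \<alpha> (mass \<rho> t) * partial_x \<phi> t x)"
  have S_lip: "1-lipschitz_on U S" for U
    unfolding S_def using a
    by (intro tail_integral_lipschitz integrable_continuous_real) (auto intro: continuous_on_subset)
  have S_nonneg: "0 \<le> S t" for t
    unfolding S_def using a(2)
    by (intro integral_nonneg integrable_continuous_real continuous_on_subset[OF a(1)]) auto
  have S_deriv: "(S has_real_derivative - a t) (at t within {0..T})" if "t \<in> {0<..<\<tau>}" for t
    unfolding S_def using that \<tau> by (intro tail_integral_has_derivative[OF a(1)]) auto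
  have test: "\<phi> \<in> test_functions T"
    unfolding \<phi>_def using S_lip S_nonneg by (rule shift_test_function)
  have cont: "continuous_on X (\<lambda>p. \<psi>' (snd p + S (fst p)))" for X
    by (intro continuous_intros continuous_on_compose2[OF cont_deriv]
        continuous_on_compose2[OF lipschitz_on_continuous_on[OF S_lip[of UNIV]]]) auto
  have cont_x: "continuous_on X (\<lambda>x. \<psi>' (x + S t))" for X t
    by (intro continuous_intros continuous_on_compose2[OF cont_deriv]) auto
  have dt: "partial_t T \<phi> t x = \<psi>' (x + S t) * - a t" if "t \<in> {0<..<\<tau>}" for t x
    unfolding \<phi>_def by (rule partial_t_shift[OF T_pos _ S_deriv]) (use that \<tau> in auto)
  have dx: "partial_x \<phi> t x = \<psi>' (x + S t)" if "x \<in> {0..1}" for t x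
    unfolding \<phi>_def using that by (rule partial_x_shift)
  have bnd: "\<bar>\<psi>' (x + S t)\<bar> \<le> B" if "x \<in> {0..<1}" for x t
    using that S_nonneg[of t] by (intro deriv_bound) auto
  have "partial_t_integrable T \<rho> \<tau> \<phi>"
    unfolding partial_t_integrable_def
  proof (intro conjI)
    show "AE t in lebesgue_on {0<..\<tau>}.
        (AE x in \<rho> t. (\<lambda>s. \<phi> s x) differentiable (at t within {0..T})) \<and>
        integrable (\<rho> t) (partial_t T \<phi> t)"
    \<comment> \<open>The single time \<open>\<tau>\<close> is discarded, because the kink of
      \<open>S\<close> there may destroy the time derivative.\<close>
    proof (subst AE_restrict_space_iff, simp, use AE_lebesgue_neq[of \<tau>] in eventually_elim, intro impI)
      fix t assume "t \<noteq> \<tau>" "t \<in> {0<..\<tau>}"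
      then have t: "t \<in> {0<..<\<tau>}" "t \<in> {0..T}" using \<tau> by auto
      have "(\<lambda>s. \<phi> s x) differentiable (at t within {0..T})" for x
        unfolding \<phi>_def
        using shift_has_time_derivative[OF S_deriv[OF t(1)]] real_differentiable_def by blast
      moreover have "integrable (\<rho> t) (\<lambda>x. \<psi>' (x + S t) * - a t)"
        by (intro rho_integrable t(2) continuous_intros cont_x)
      ultimately show "(AE x in \<rho> t. (\<lambda>s. \<phi> s x) differentiable (at t within {0..T})) \<and>
          integrable (\<rho> t) (partial_t T \<phi> t)"
        using dt[OF t(1)] by (simp cong: Bochner_Integration.integrable_cong)
    qed
    \<comment> \<open>Before \<open>\<tau>\<close> this equals the absolute moment of
      \<open>partial_t\<close>. It is dominated by a multiple of the mass, which is integrable in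
      time for a solution.\<close>
    have "(\<lambda>t. a t * (LINT x|\<rho> t. \<bar>\<psi>' (x + S t)\<bar>)) absolutely_integrable_on {0<..\<tau>}"
    proof (rule measurable_bounded_by_integrable_imp_absolutely_integrable)
      have "(\<lambda>t. LINT x|\<rho> t. \<bar>\<psi>' (x + S t)\<bar>) \<in> borel_measurable (lebesgue_on {0<..T})"
        by (intro parametric_moment_measurable continuous_intros cont)
      then have "(\<lambda>t. LINT x|\<rho> t. \<bar>\<psi>' (x + S t)\<bar>) \<in> borel_measurable (lebesgue_on {0<..\<tau>})"
        by (rule measurable_restrict_mono) (use \<tau> in auto)
      moreover have "a \<in> borel_measurable (lebesgue_on {0<..\<tau>})"
        by (intro continuous_imp_measurable_on_sets_lebesgue continuous_on_subset[OF a(1)]) auto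
      ultimately show "(\<lambda>t. a t * (LINT x|\<rho> t. \<bar>\<psi>' (x + S t)\<bar>))
          \<in> borel_measurable (lebesgue_on {0<..\<tau>})"
        by (intro borel_measurable_times)
      show "(\<lambda>t. B * mass \<rho> t) integrable_on {0<..\<tau>}"
        using set_lebesgue_integral_eq_integral(1)[OF mass_integrable_on[OF \<tau>]]
        by (rule integrable_on_mult_right)
      show "norm (a t * (LINT x|\<rho> t. \<bar>\<psi>' (x + S t)\<bar>)) \<le> B * mass \<rho> t" if "t \<in> {0<..\<tau>}" for t
      proof -
        have "\<bar>LINT x|\<rho> t. \<bar>\<psi>' (x + S t)\<bar>\<bar> \<le> B * mass \<rho> t"
          using that \<tau> bnd bound_nonneg by (intro rho_integral_bound) auto
        then have "\<bar>a t\<bar> * \<bar>LINT x|\<rho> t. \<bar>\<psi>' (x + S t)\<bar>\<bar> \<le> 1 * (B * mass \<rho> t)"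
          using a by (intro mult_mono) auto
        then show ?thesis by (simp add: abs_mult)
      qed
    qed auto
    then show "set_integrable lebesgue {0<..\<tau>} (\<lambda>t. LINT x|\<rho> t. \<bar>partial_t T \<phi> t x\<bar>)"
    proof (rule absolutely_integrable_spike)
      show "negligible {\<tau>}" by simp
      show "(LINT x|\<rho> t. \<bar>partial_t T \<phi> t x\<bar>) = a t * (LINT x|\<rho> t. \<bar>\<psi>' (x + S t)\<bar>)"
        if "t \<in> {0<..\<tau>} - {\<tau>}" for t
        using dt[of t] that a(2)[of t] by (simp add: abs_mult mult.commute)
    qed
  qed
  then have "set_integrable lebesgue {0<..\<tau>} F \<and>
      0 = (LINT t:{0<..\<tau>}|lebesgue. F t) + (LINT t:{0<..\<tau>}|\<mu>. \<phi> t 0)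
        - (LINT x|\<rho> \<tau>. \<phi> \<tau> x) + (LINT x|\<rho>0. \<phi> 0 x)"
    using solution test \<tau> unfolding weak_solution_def F_def by blast
  \<comment> \<open>Since \<open>S \<tau> = 0\<close>, the moving test function arrives at time
    \<open>\<tau>\<close> as the prescribed profile \<open>\<psi>\<close>.\<close>
  moreover have "\<phi> t 0 = \<psi> (S t)" "\<phi> \<tau> x = \<psi> x" for t x by (simp_all add: \<phi>_def S_def)
  moreover have "\<bar>F t\<bar> \<le> \<bar>vel t - a t\<bar> * (B * mass \<rho> t)" if "t \<in> {0<..<\<tau>}" for t
  proof -
    have t: "t \<in> {0..T}" using that \<tau> by auto
    \<comment> \<open>The time derivative contributes \<open>- a t\<close> and the flux
      \<open>vel t\<close>, both times the same value of \<open>\<psi>'\<close>; only the error in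
      the speed remains.\<close>
    have "F t = (LINT x|\<rho> t. (vel t - a t) * \<psi>' (x + S t))"
      unfolding F_def
    proof (rule Bochner_Integration.integral_cong)
      fix x assume "x \<in> space (\<rho> t)"
      then have "x \<in> {0..1}" using finite_borel_measuresD(3)[OF rho[OF t]] by auto
      then show "partial_t T \<phi> t x + \<alpha> (mass \<rho> t) * partial_x \<phi> t x = (vel t - a t) * \<psi>' (x + S t)"
        using dt[OF that] dx vel_eq[OF t] by (simp add: algebra_simps)
    qed simp
    also have "\<bar>\<dots>\<bar> = \<bar>vel t - a t\<bar> * \<bar>LINT x|\<rho> t. \<psi>' (x + S t)\<bar>"
      by (simp add: abs_mult)
    also have "\<dots> \<le> \<bar>vel t - a t\<bar> * (B * mass \<rho> t)"
      using bnd bound_nonneg by (intro mult_left_mono rho_integral_bound t) auto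
    finally show ?thesis .
  qed
  ultimately show thesis using that[of F] by (simp add: \<phi>_def)
qed

text \<open>The measurable speed \<open>vel\<close> is an almost everywhere limit of continuous
  speeds \<open>a n\<close>. By \<open>approximate_transport\<close> the formula holds for each
  \<open>a n\<close> up to a residual controlled by \<open>\<bar>vel t - a n t\<bar>\<close>, and
  all terms pass to the limit by dominated convergence.\<close>

theorem transport_formula:
  assumes "cutoff \<psi> \<psi>' B" and \<tau>: "\<tau> \<in> {0..T}"
  shows "(LINT x|\<rho> \<tau>. \<psi> x) =
    (LINT t:{0<..\<tau>}|\<mu>. \<psi> (integral {t..\<tau>} vel)) + (LINT x|\<rho>0. \<psi> (x + integral {0..\<tau>} vel))"
proof -
  interpret cutoff \<psi> \<psi>' B by fact
  interpret M: finite_measure \<mu> using finite_borel_measuresD(1)[OF boundary] .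
  interpret R: finite_measure \<rho>0 using finite_borel_measuresD(1)[OF initial] .
  obtain C where C: "\<And>y. 0 \<le> y \<Longrightarrow> \<bar>\<psi> y\<bar> \<le> C" using bounded_nonneg by blast
  have C0: "0 \<le> C" using C[of 0] by simp
  have "vel measurable_on UNIV"
    using vel_measurable by (rule lebesgue_measurable_imp_measurable_on_real) simp
  then obtain N g where N: "negligible N" and g: "\<And>n. continuous_on UNIV (g n)"
    and lim_g: "\<And>t. t \<notin> N \<Longrightarrow> (\<lambda>n. g n t) \<longlonglongrightarrow> vel t"
    unfolding measurable_on_def by auto
  \<comment> \<open>Clamping supplies the bounds that \<open>approximate_transport\<close> asks for
    and does not disturb the limit, since \<open>vel\<close> already lies between 0 and 1.\<close>
  define a where "a = (\<lambda>n t. max 0 (min 1 (g n t)))"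
  have a: "continuous_on UNIV (a n)" "0 \<le> a n t" "a n t \<le> 1" for n t
    unfolding a_def by (auto intro!: continuous_intros g)
  have a_lim: "(\<lambda>n. a n t) \<longlonglongrightarrow> vel t" if "t \<notin> N" for t
  proof -
    have "(\<lambda>n. a n t) \<longlonglongrightarrow> max 0 (min 1 (vel t))"
      unfolding a_def by (intro tendsto_intros lim_g[OF that])
    then show ?thesis using vel_pos[of t] vel_le_1[of t] by simp
  qed
  have a_int: "a n integrable_on {p..q}" for n p q
    by (intro integrable_continuous_real continuous_on_subset[OF a(1)]) auto
  have S_lim: "(\<lambda>n. integral {t..\<tau>} (a n)) \<longlonglongrightarrow> integral {t..\<tau>} vel" for t
    by (rule tendsto_tail_integral[where C=1, OF a_int _ N a_lim]) (use a in auto)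
  have S_nonneg: "0 \<le> integral {t..\<tau>} (a n)" for t n
    using a by (intro integral_nonneg a_int) auto
  have S_cont: "continuous_on U (\<lambda>t. integral {t..\<tau>} (a n))" for n U
    by (intro lipschitz_on_continuous_on[OF tail_integral_lipschitz] a_int a)
  note psi_tendsto = continuous_on_tendsto_compose[OF cont _ UNIV_I always_eventually[OF allI[OF UNIV_I]]]
  note psi_cont = continuous_on_compose2[OF cont _ subset_UNIV]
  have "\<exists>F. set_integrable lebesgue {0<..\<tau>} F \<and>
      (\<forall>t\<in>{0<..<\<tau>}. \<bar>F t\<bar> \<le> \<bar>vel t - a n t\<bar> * (B * mass \<rho> t)) \<and>
      0 = (LINT t:{0<..\<tau>}|lebesgue. F t) + (LINT t:{0<..\<tau>}|\<mu>. \<psi> (integral {t..\<tau>} (a n)))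
        - (LINT x|\<rho> \<tau>. \<psi> x) + (LINT x|\<rho>0. \<psi> (x + integral {0..\<tau>} (a n)))" for n
    by (rule approximate_transport[OF assms a]) blast
  then obtain F where F: "\<And>n. set_integrable lebesgue {0<..\<tau>} (F n)"
    and F_le: "\<And>n t. t \<in> {0<..<\<tau>} \<Longrightarrow> \<bar>F n t\<bar> \<le> \<bar>vel t - a n t\<bar> * (B * mass \<rho> t)"
    and eq: "\<And>n. 0 = (LINT t:{0<..\<tau>}|lebesgue. F n t)
        + (LINT t:{0<..\<tau>}|\<mu>. \<psi> (integral {t..\<tau>} (a n)))
        - (LINT x|\<rho> \<tau>. \<psi> x) + (LINT x|\<rho>0. \<psi> (x + integral {0..\<tau>} (a n)))"
    by metis
  \<comment> \<open>The speed error is at most 1, so \<open>B * mass \<rho> t\<close> dominates all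
    residuals; they tend to 0 off the null set \<open>N\<close> and the endpoint
    \<open>\<tau>\<close>.\<close>
  have "(\<lambda>n. LINT t:{0<..\<tau>}|lebesgue. F n t) \<longlonglongrightarrow> (LINT t|(lebesgue :: real measure). 0)"
    unfolding set_lebesgue_integral_def
  proof (rule integral_dominated_convergence)
    show "(\<lambda>t. indicator {0<..\<tau>} t *\<^sub>R F n t) \<in> borel_measurable lebesgue" for n
      using F[of n] by (auto simp: set_integrable_def)
    have "integrable lebesgue (\<lambda>t. B * (indicator {0<..\<tau>} t *\<^sub>R mass \<rho> t))"
      using mass_integrable_on[OF \<tau>] by (intro integrable_mult_right) (simp add: set_integrable_def)
    then show "integrable lebesgue (\<lambda>t. indicator {0<..\<tau>} t * (B * mass \<rho> t))"
      by (simp add: mult.left_commute)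
    show "AE t in lebesgue. norm (indicator {0<..\<tau>} t *\<^sub>R F n t) \<le> indicator {0<..\<tau>} t * (B * mass \<rho> t)"
      for n
      using AE_lebesgue_neq[of \<tau>]
    proof eventually_elim
      case (elim t)
      have "\<bar>F n t\<bar> \<le> B * mass \<rho> t" if "t \<in> {0<..<\<tau>}"
      proof -
        have "\<bar>vel t - a n t\<bar> * (B * mass \<rho> t) \<le> 1 * (B * mass \<rho> t)"
          using vel_pos[of t] vel_le_1[of t] a(2,3)[of n t] bound_nonneg mass_nonneg[of t]
          by (intro mult_right_mono) auto
        then show ?thesis using F_le[OF that, of n] by simp
      qed
      then show ?case using elim by (auto simp: indicator_def)
    qed
    have "AE t in lebesgue. t \<notin> N"
      using N by (intro AE_not_in) (simp add: negligible_iff_null_sets)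
    then show "AE t in lebesgue. (\<lambda>n. indicator {0<..\<tau>} t *\<^sub>R F n t) \<longlonglongrightarrow> 0"
      using AE_lebesgue_neq[of \<tau>]
    proof eventually_elim
      case (elim t)
      show ?case
      proof (cases "t \<in> {0<..<\<tau>}")
        case True
        have "(\<lambda>n. \<bar>vel t - a n t\<bar> * (B * mass \<rho> t)) \<longlonglongrightarrow> \<bar>vel t - vel t\<bar> * (B * mass \<rho> t)"
          using elim by (intro tendsto_intros a_lim)
        then have "(\<lambda>n. \<bar>vel t - a n t\<bar> * (B * mass \<rho> t)) \<longlonglongrightarrow> 0" by simp
        then have "(\<lambda>n. F n t) \<longlonglongrightarrow> 0"
          by (rule Lim_null_comparison[rotated]) (use F_le[OF True] in auto)
        then show ?thesis using True by simp
      qed (use elim in \<open>auto simp: indicator_def\<close>)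
    qed
  qed simp
  moreover have "(\<lambda>n. LINT t:{0<..\<tau>}|\<mu>. \<psi> (integral {t..\<tau>} (a n)))
      \<longlonglongrightarrow> (LINT t:{0<..\<tau>}|\<mu>. \<psi> (integral {t..\<tau>} vel))"
    unfolding set_lebesgue_integral_def
  proof (rule integral_dominated_convergence)
    show "integrable \<mu> (\<lambda>t. C)" by simp
    show "(\<lambda>t. indicator {0<..\<tau>} t *\<^sub>R \<psi> (integral {t..\<tau>} vel)) \<in> borel_measurable \<mu>"
      "\<And>n. (\<lambda>t. indicator {0<..\<tau>} t *\<^sub>R \<psi> (integral {t..\<tau>} (a n))) \<in> borel_measurable \<mu>"
      by (intro finite_borel_measures_measurable[OF boundary] borel_measurable_scaleR
          borel_measurable_indicator borel_measurable_continuous_onI psi_cont S_cont vel_tail_continuous; simp)+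
    show "AE t in \<mu>. (\<lambda>n. indicator {0<..\<tau>} t *\<^sub>R \<psi> (integral {t..\<tau>} (a n)))
        \<longlonglongrightarrow> indicator {0<..\<tau>} t *\<^sub>R \<psi> (integral {t..\<tau>} vel)"
      by (intro AE_I2 tendsto_intros psi_tendsto S_lim)
    show "AE t in \<mu>. norm (indicator {0<..\<tau>} t *\<^sub>R \<psi> (integral {t..\<tau>} (a n))) \<le> C" for n
      using C[OF S_nonneg] C0 by (intro AE_I2) (auto simp: indicator_def)
  qed
  moreover have "(\<lambda>n. LINT x|\<rho>0. \<psi> (x + integral {0..\<tau>} (a n)))
      \<longlonglongrightarrow> (LINT x|\<rho>0. \<psi> (x + integral {0..\<tau>} vel))"
  proof (rule integral_dominated_convergence)
    show "integrable \<rho>0 (\<lambda>x. C)" by simp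
    show "(\<lambda>x. \<psi> (x + integral {0..\<tau>} vel)) \<in> borel_measurable \<rho>0"
      "\<And>n. (\<lambda>x. \<psi> (x + integral {0..\<tau>} (a n))) \<in> borel_measurable \<rho>0"
      by (intro finite_borel_measures_measurable[OF initial]
          borel_measurable_continuous_onI psi_cont continuous_intros)+
    show "AE x in \<rho>0. (\<lambda>n. \<psi> (x + integral {0..\<tau>} (a n))) \<longlonglongrightarrow> \<psi> (x + integral {0..\<tau>} vel)"
      by (intro AE_I2 psi_tendsto tendsto_add tendsto_const S_lim)
    show "AE x in \<rho>0. norm (\<psi> (x + integral {0..\<tau>} (a n))) \<le> C" for n
      using C S_nonneg finite_borel_measuresD(3)[OF initial] by (intro AE_I2) auto
  qed
  ultimately have "(\<lambda>n. (LINT t:{0<..\<tau>}|lebesgue. F n t)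
        + (LINT t:{0<..\<tau>}|\<mu>. \<psi> (integral {t..\<tau>} (a n)))
        - (LINT x|\<rho> \<tau>. \<psi> x) + (LINT x|\<rho>0. \<psi> (x + integral {0..\<tau>} (a n))))
      \<longlonglongrightarrow> (LINT t|(lebesgue :: real measure). 0) + (LINT t:{0<..\<tau>}|\<mu>. \<psi> (integral {t..\<tau>} vel))
        - (LINT x|\<rho> \<tau>. \<psi> x) + (LINT x|\<rho>0. \<psi> (x + integral {0..\<tau>} vel))"
    by (intro tendsto_intros)
  then have "(\<lambda>n. 0) \<longlonglongrightarrow> (LINT t|(lebesgue :: real measure). 0) + (LINT t:{0<..\<tau>}|\<mu>. \<psi> (integral {t..\<tau>} vel))
        - (LINT x|\<rho> \<tau>. \<psi> x) + (LINT x|\<rho>0. \<psi> (x + integral {0..\<tau>} vel))"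
    unfolding eq[symmetric] .
  then show ?thesis
    using LIMSEQ_unique[OF tendsto_const] by fastforce
qed

end

section \<open>Smooth approximation of the indicator of a half-line\<close>

lemma positive_part_square_deriv:
  "((\<lambda>y::real. (max 0 (b - y))\<^sup>2) has_real_derivative - 2 * max 0 (b - y)) (at y)"
proof -
  consider "y < b" | "b < y" | "y = b" by linarith
  then show ?thesis
  proof cases
    case 1
    have "((\<lambda>y. (b - y)\<^sup>2) has_real_derivative - 2 * max 0 (b - y)) (at y)"
      using 1 by (auto intro!: derivative_eq_intros)
    then show ?thesis
      by (rule has_field_derivative_transform_within_open[of _ _ _ "{..<b}"]) (use 1 in auto)
  next
    case 2
    have "((\<lambda>y. 0) has_real_derivative - 2 * max 0 (b - y)) (at y)"
      using 2 by (auto intro!: derivative_eq_intros)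
    then show ?thesis
      by (rule has_field_derivative_transform_within_open[of _ _ _ "{b<..}"]) (use 2 in auto)
  next
    case 3
    show ?thesis
      \<comment> \<open>At the junction \<open>y = b\<close> Caratheodory's criterion applies: the
        slope function \<open>- max 0 (b - z)\<close> is continuous and vanishes at
        \<open>b\<close>.\<close>
      unfolding CARAT_DERIV
    proof (intro exI conjI allI)
      show "(max 0 (b - z))\<^sup>2 - (max 0 (b - y))\<^sup>2 = - max 0 (b - z) * (z - y)" for z
        using 3 by (simp add: max_def power2_eq_square algebra_simps)
      show "isCont (\<lambda>z. - max 0 (b - z)) y" by (intro continuous_intros)
      show "- max 0 (b - y) = - 2 * max 0 (b - y)" using 3 by simp
    qed
  qed
qed

text \<open>A continuously differentiable profile that vanishes from \<open>b\<close> on and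
  increases with \<open>k\<close> to the indicator of \<open>{..<b}\<close>; squaring the positive
  part removes its kink.\<close>

definition smooth_step :: "real \<Rightarrow> nat \<Rightarrow> real \<Rightarrow> real" where
  "smooth_step b k y = 1 - exp (- (real k * (max 0 (b - y))\<^sup>2))"

text \<open>Because \<open>b \<le> 1\<close>, the profile vanishes from 1 on, and
  \<open>max 0 (b - y) \<le> 1\<close> for nonnegative \<open>y\<close>. As the exponential factor
  is at most 1, this gives the bound \<open>2 * real k\<close>.\<close>

lemma cutoff_smooth_step:
  assumes "b \<le> 1"
  shows "cutoff (smooth_step b k)
    (\<lambda>y. - (2 * real k * max 0 (b - y)) * exp (- (real k * (max 0 (b - y))\<^sup>2))) (2 * real k)"
proof
  show "(smooth_step b k has_real_derivative
      - (2 * real k * max 0 (b - y)) * exp (- (real k * (max 0 (b - y))\<^sup>2))) (at y)" for y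
    unfolding smooth_step_def[abs_def]
    by (rule derivative_eq_intros positive_part_square_deriv refl | simp)+
  show "continuous_on UNIV
      (\<lambda>y. - (2 * real k * max 0 (b - y)) * exp (- (real k * (max 0 (b - y))\<^sup>2)))"
    by (intro continuous_intros)
  show "\<bar>- (2 * real k * max 0 (b - y)) * exp (- (real k * (max 0 (b - y))\<^sup>2))\<bar> \<le> 2 * real k"
    if "0 \<le> y" for y
  proof -
    have "(2 * real k * max 0 (b - y)) * exp (- (real k * (max 0 (b - y))\<^sup>2)) \<le> (2 * real k * 1) * 1"
      using that assms by (intro mult_mono) auto
    then show ?thesis by (simp add: abs_mult)
  qed
  show "smooth_step b k y = 0" if "1 \<le> y" for y
    using that assms by (simp add: smooth_step_def)
qed

lemma smooth_step_bound: "\<bar>smooth_step b k y\<bar> \<le> 1"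
  by (simp add: smooth_step_def abs_le_iff)

lemma smooth_step_tendsto: "(\<lambda>k. smooth_step b k y) \<longlonglongrightarrow> indicator {..<b} y"
proof (cases "y < b")
  case True
  define q where "q = (max 0 (b - y))\<^sup>2"
  have "norm (exp (- q)) < 1" using True by (simp add: q_def)
  then have "(\<lambda>k. 1 - exp (- q) ^ k) \<longlonglongrightarrow> 1 - 0"
    by (intro tendsto_diff tendsto_const LIMSEQ_power_zero)
  moreover have "exp (- q) ^ k = exp (- (real k * q))" for k
    by (simp flip: exp_of_nat_mult)
  ultimately show ?thesis
    using True unfolding smooth_step_def q_def[symmetric] by simp
qed (simp add: smooth_step_def)

section \<open>Distribution function of the solution\<close>

context transport
begin

text \<open>Limit of \<open>transport_formula\<close> along \<open>smooth_step b k\<close> as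
  \<open>k\<close> grows, with the constant 1 as dominating function. The limit is the indicator of
  the open ray \<open>{..<b}\<close>, so the inequalities are strict and atoms are counted
  correctly.\<close>

theorem measure_formula:
  assumes \<tau>: "\<tau> \<in> {0..T}" and b: "b \<le> 1"
  shows "measure (\<rho> \<tau>) {0..<b} = measure \<mu> {t \<in> {0<..\<tau>}. integral {t..\<tau>} vel < b}
    + measure \<rho>0 {x \<in> {0..<1}. x + integral {0..\<tau>} vel < b}"
proof -
  interpret M: finite_measure \<mu> using finite_borel_measuresD(1)[OF boundary] .
  interpret R: finite_measure \<rho>0 using finite_borel_measuresD(1)[OF initial] .
  interpret P: finite_measure "\<rho> \<tau>" using finite_borel_measuresD(1)[OF rho[OF \<tau>]] .
  have step_meas: "smooth_step b k \<in> borel_measurable borel" for k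
    unfolding smooth_step_def[abs_def] by measurable
  have vel_meas: "(\<lambda>t. integral {t..\<tau>} vel) \<in> borel_measurable borel"
    by (rule borel_measurable_continuous_onI[OF vel_tail_continuous])
  have "(\<lambda>k. LINT x|\<rho> \<tau>. smooth_step b k x) \<longlonglongrightarrow> (LINT x|\<rho> \<tau>. indicator {..<b} x)"
  proof (rule integral_dominated_convergence)
    show "indicator {..<b} \<in> borel_measurable (\<rho> \<tau>)"
      by (rule finite_borel_measures_measurable[OF rho[OF \<tau>]]) simp
    show "smooth_step b k \<in> borel_measurable (\<rho> \<tau>)" for k
      using rho[OF \<tau>] step_meas by (rule finite_borel_measures_measurable)
    show "integrable (\<rho> \<tau>) (\<lambda>x. 1 :: real)" by simp
  qed (auto intro!: AE_I2 smooth_step_tendsto smooth_step_bound)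
  moreover have "(\<lambda>k. LINT t:{0<..\<tau>}|\<mu>. smooth_step b k (integral {t..\<tau>} vel))
      \<longlonglongrightarrow> (LINT t:{0<..\<tau>}|\<mu>. indicator {..<b} (integral {t..\<tau>} vel))"
    unfolding set_lebesgue_integral_def
  proof (rule integral_dominated_convergence)
    show "(\<lambda>t. indicator {0<..\<tau>} t *\<^sub>R indicator {..<b} (integral {t..\<tau>} vel) :: real) \<in> borel_measurable \<mu>"
      by (intro finite_borel_measures_measurable[OF boundary] borel_measurable_scaleR
          borel_measurable_indicator measurable_compose[OF vel_meas]) simp_all
    show "(\<lambda>t. indicator {0<..\<tau>} t *\<^sub>R smooth_step b k (integral {t..\<tau>} vel)) \<in> borel_measurable \<mu>" for k
      by (intro finite_borel_measures_measurable[OF boundary] borel_measurable_scaleR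
          borel_measurable_indicator measurable_compose[OF vel_meas step_meas]) simp_all
    show "integrable \<mu> (\<lambda>x. 1 :: real)" by simp
    show "AE t in \<mu>. norm (indicator {0<..\<tau>} t *\<^sub>R smooth_step b k (integral {t..\<tau>} vel)) \<le> 1" for k
      by (intro AE_I2) (simp add: indicator_def smooth_step_bound)
  qed (auto intro!: AE_I2 tendsto_intros smooth_step_tendsto)
  moreover have "(\<lambda>k. LINT x|\<rho>0. smooth_step b k (x + integral {0..\<tau>} vel))
      \<longlonglongrightarrow> (LINT x|\<rho>0. indicator {..<b} (x + integral {0..\<tau>} vel))"
  proof (rule integral_dominated_convergence)
    have shift: "(\<lambda>x. x + integral {0..\<tau>} vel) \<in> borel_measurable borel" by simp
    show "(\<lambda>x. indicator {..<b} (x + integral {0..\<tau>} vel) :: real) \<in> borel_measurable \<rho>0"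
      by (intro finite_borel_measures_measurable[OF initial] measurable_compose[OF shift]) simp
    show "(\<lambda>x. smooth_step b k (x + integral {0..\<tau>} vel)) \<in> borel_measurable \<rho>0" for k
      by (intro finite_borel_measures_measurable[OF initial] measurable_compose[OF shift step_meas])
    show "integrable \<rho>0 (\<lambda>x. 1 :: real)" by simp
  qed (auto intro!: AE_I2 smooth_step_tendsto smooth_step_bound)
  ultimately have "(LINT x|\<rho> \<tau>. indicator {..<b} x)
      = (LINT t:{0<..\<tau>}|\<mu>. indicator {..<b} (integral {t..\<tau>} vel))
        + (LINT x|\<rho>0. indicator {..<b} (x + integral {0..\<tau>} vel) :: real)"
    unfolding transport_formula[OF cutoff_smooth_step[OF b] \<tau>]
    by (intro LIMSEQ_unique[OF _ tendsto_add])
  moreover have "(LINT x|\<rho> \<tau>. indicator {..<b} x) = measure (\<rho> \<tau>) {0..<b}"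
  proof -
    have "{..<b} \<inter> {0..<1} = {0..<b}" using b by auto
    then show ?thesis using finite_borel_measuresD(3)[OF rho[OF \<tau>]] by simp
  qed
  moreover have "(LINT t:{0<..\<tau>}|\<mu>. indicator {..<b} (integral {t..\<tau>} vel) :: real)
      = measure \<mu> {t \<in> {0<..\<tau>}. integral {t..\<tau>} vel < b}"
  proof -
    have "(LINT t:{0<..\<tau>}|\<mu>. indicator {..<b} (integral {t..\<tau>} vel) :: real)
        = (LINT t|\<mu>. indicator {t \<in> {0<..\<tau>}. integral {t..\<tau>} vel < b} t)"
      unfolding set_lebesgue_integral_def
      by (rule Bochner_Integration.integral_cong) (auto simp: indicator_def)
    moreover have "{t \<in> {0<..\<tau>}. integral {t..\<tau>} vel < b} \<inter> {0<..T}
        = {t \<in> {0<..\<tau>}. integral {t..\<tau>} vel < b}" using \<tau> by auto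
    ultimately show ?thesis using finite_borel_measuresD(3)[OF boundary] by simp
  qed
  moreover have "(LINT x|\<rho>0. indicator {..<b} (x + integral {0..\<tau>} vel) :: real)
      = measure \<rho>0 {x \<in> {0..<1}. x + integral {0..\<tau>} vel < b}"
  proof -
    have "(LINT x|\<rho>0. indicator {..<b} (x + integral {0..\<tau>} vel) :: real)
        = (LINT x|\<rho>0. indicator {x \<in> {0..<1}. x + integral {0..\<tau>} vel < b} x)"
      using finite_borel_measuresD(3)[OF initial]
      by (intro Bochner_Integration.integral_cong) (auto simp: indicator_def)
    moreover have "{x \<in> {0..<1}. x + integral {0..\<tau>} vel < b} \<inter> {0..<1}
        = {x \<in> {0..<1}. x + integral {0..\<tau>} vel < b}" by auto
    ultimately show ?thesis using finite_borel_measuresD(3)[OF initial] by simp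
  qed
  ultimately show ?thesis by simp
qed

end

section \<open>Comparison of two solutions\<close>

text \<open>A nonempty \<open>E\<close> is contained in \<open>{Inf E..Inf E + d}\<close>.\<close>

lemma emeasure_lborel_le_diameter:
  assumes E: "E \<in> sets borel" and diam: "\<And>s t. s \<in> E \<Longrightarrow> t \<in> E \<Longrightarrow> s \<le> t \<Longrightarrow> t - s \<le> (d::real)"
  shows "emeasure lborel E \<le> ennreal d"
proof (cases "E = {}")
  case False
  then obtain e where e: "e \<in> E" by blast
  \<comment> \<open>Applying \<open>diam\<close> to \<open>t\<close> twice gives
    \<open>0 \<le> d\<close>, which settles the case \<open>t < s\<close>.\<close>
  have below: "t - d \<le> s" if "s \<in> E" "t \<in> E" for s t
    using diam[of s t] diam[of t t] that by (cases "s \<le> t") auto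
  have bdd: "bdd_below E" using below[OF _ e] by (rule bdd_belowI)
  have "E \<subseteq> {Inf E..Inf E + d}"
  proof
    fix t assume t: "t \<in> E"
    have "t - d \<le> Inf E" using below[OF _ t] False by (intro cInf_greatest) auto
    then show "t \<in> {Inf E..Inf E + d}" using cInf_lower[OF t bdd] by simp
  qed
  then have "emeasure lborel E \<le> emeasure lborel {Inf E..Inf E + d}"
    by (rule emeasure_mono) simp
  also have "\<dots> = ennreal d" using diam[OF e e] by simp
  finally show ?thesis .
qed simp

text \<open>By Tonelli: each level \<open>g z\<close> separates the two curves only during a time interval of length
  at most \<open>2 D / c\<close>. This replaces a modulus of continuity of the distribution function of \<open>g\<close>,
  which may well have jumps.\<close>

lemma nn_integral_separated_levels_le:
  fixes X Y :: "real \<Rightarrow> real"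
  assumes "finite_measure \<nu>" and g[measurable]: "g \<in> borel_measurable \<nu>"
    and Z[measurable]: "Z \<in> sets \<nu>"
    and X[measurable]: "X \<in> borel_measurable borel" and Y[measurable]: "Y \<in> borel_measurable borel"
    and c: "0 < c" and expanding: "\<And>s t. p \<le> s \<Longrightarrow> s \<le> t \<Longrightarrow> t \<le> q \<Longrightarrow> c * (t - s) \<le> X t - X s"
    and close: "\<And>s. s \<in> {p..q} \<Longrightarrow> \<bar>X s - Y s\<bar> \<le> D"
    and range: "\<And>s. s \<in> {p..q} \<Longrightarrow> X s \<in> {l..h} \<and> Y s \<in> {l..h}"
  shows "(\<lambda>s. indicator {p..q} s * emeasure \<nu> {z \<in> Z. min (X s) (Y s) < g z \<and> g z \<le> max (X s) (Y s)})
    \<in> borel_measurable lborel" (is ?meas)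
    and "(\<integral>\<^sup>+s. indicator {p..q} s * emeasure \<nu> {z \<in> Z. min (X s) (Y s) < g z \<and> g z \<le> max (X s) (Y s)} \<partial>lborel)
    \<le> ennreal (2 * D / c) * emeasure \<nu> {z \<in> Z. l < g z \<and> g z \<le> h}" (is ?le)
proof -
  interpret N: finite_measure \<nu> by fact
  interpret P: pair_sigma_finite lborel \<nu> ..
  have Z_space: "Z \<subseteq> space \<nu>" using Z by (rule sets.sets_into_space)
  define A where "A = {w \<in> space (lborel \<Otimes>\<^sub>M \<nu>). fst w \<in> {p..q} \<and> snd w \<in> Z \<and>
    min (X (fst w)) (Y (fst w)) < g (snd w) \<and> g (snd w) \<le> max (X (fst w)) (Y (fst w))}"
  have A: "A \<in> sets (lborel \<Otimes>\<^sub>M \<nu>)" unfolding A_def by measurable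
  have "Pair s -` A = (if s \<in> {p..q}
      then {z \<in> Z. min (X s) (Y s) < g z \<and> g z \<le> max (X s) (Y s)} else {})" for s
    using Z_space by (auto simp: A_def space_pair_measure)
  then have slice: "indicator {p..q} s * emeasure \<nu> {z \<in> Z. min (X s) (Y s) < g z \<and> g z \<le> max (X s) (Y s)}
      = emeasure \<nu> (Pair s -` A)" for s
    by (simp add: indicator_def)
  show ?meas unfolding slice by (rule N.measurable_emeasure_Pair[OF A])
  have "(\<integral>\<^sup>+s. indicator {p..q} s * emeasure \<nu> {z \<in> Z. min (X s) (Y s) < g z \<and> g z \<le> max (X s) (Y s)} \<partial>lborel)
      = (\<integral>\<^sup>+s. emeasure \<nu> (Pair s -` A) \<partial>lborel)"
    unfolding slice ..
  also have "\<dots> = emeasure (lborel \<Otimes>\<^sub>M \<nu>) A"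
    using N.emeasure_pair_measure_alt[OF A] by simp
  also have "\<dots> = (\<integral>\<^sup>+z. emeasure lborel ((\<lambda>s. (s, z)) -` A) \<partial>\<nu>)"
    by (rule P.emeasure_pair_measure_alt2[OF A])
  also have "\<dots> \<le> (\<integral>\<^sup>+z. ennreal (2 * D / c) * indicator {z \<in> Z. l < g z \<and> g z \<le> h} z \<partial>\<nu>)"
  proof (rule nn_integral_mono)
    fix z
    let ?E = "(\<lambda>s. (s, z)) -` A"
    show "emeasure lborel ?E \<le> ennreal (2 * D / c) * indicator {z \<in> Z. l < g z \<and> g z \<le> h} z"
    proof (cases "z \<in> Z \<and> l < g z \<and> g z \<le> h")
      case True
      have "emeasure lborel ?E \<le> ennreal (2 * D / c)"
      proof (rule emeasure_lborel_le_diameter)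
        show "?E \<in> sets borel" using sets_Pair2[OF A, of z] by simp
        fix s t assume "s \<in> ?E" "t \<in> ?E" "s \<le> t"
        then have st: "s \<in> {p..q}" "t \<in> {p..q}" "s \<le> t"
          and "min (X t) (Y t) < g z" "g z \<le> max (X s) (Y s)"
          by (auto simp: A_def)
        \<comment> \<open>The level \<open>g z\<close> lies between the curves at both times, and
          the curves are at most \<open>D\<close> apart. Hence \<open>X t\<close> is at most
          \<open>g z + D\<close> and \<open>X s\<close> is at least \<open>g z - D\<close>.\<close>
        then have "X t - X s \<le> 2 * D"
          using close[of s] close[of t] by (simp add: min_def max_def abs_le_iff split: if_splits)
        then have "c * (t - s) \<le> 2 * D" using expanding[of s t] st by auto
        then show "t - s \<le> 2 * D / c" using c by (simp add: field_simps)
      qed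
      then show ?thesis using True by simp
    next
      case False
      \<comment> \<open>Both curves stay in \<open>{l..h}\<close>, so a level strictly above the
        lower one and not above the upper one lies in \<open>{l<..h}\<close>.\<close>
      have "?E = {}"
      proof (rule ccontr)
        assume "?E \<noteq> {}"
        then obtain s where "(s, z) \<in> A" by blast
        then have "z \<in> Z" "s \<in> {p..q}" "min (X s) (Y s) < g z" "g z \<le> max (X s) (Y s)"
          by (auto simp: A_def)
        then show False using False range[of s] by (auto simp: min_def max_def split: if_splits)
      qed
      then show ?thesis by simp
    qed
  qed
  also have "\<dots> = ennreal (2 * D / c) * emeasure \<nu> {z \<in> Z. l < g z \<and> g z \<le> h}"
  proof (rule nn_integral_cmult_indicator)
    have "{z \<in> Z. l < g z \<and> g z \<le> h} = Z \<inter> {z \<in> space \<nu>. l < g z \<and> g z \<le> h}"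
      using Z_space by auto
    also have "\<dots> \<in> sets \<nu>" by measurable
    finally show "{z \<in> Z. l < g z \<and> g z \<le> h} \<in> sets \<nu>" .
  qed
  finally show ?le .
qed

text \<open>The sets decrease to the empty set because the level \<open>l\<close> itself is
  excluded; mass concentrated at level \<open>l\<close> is not counted.\<close>

lemma measure_right_gap_tendsto_0:
  assumes "finite_measure \<nu>" and g[measurable]: "g \<in> borel_measurable \<nu>"
    and Z[measurable]: "Z \<in> sets \<nu>"
  shows "(\<lambda>n. measure \<nu> {z \<in> Z. l < g z \<and> g z \<le> l + 1 / real (Suc n)}) \<longlonglongrightarrow> 0"
proof -
  interpret finite_measure \<nu> by fact
  define A where "A = (\<lambda>n. {z \<in> Z. l < g z \<and> g z \<le> l + 1 / real (Suc n)})"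
  have "A n = Z \<inter> {z \<in> space \<nu>. l < g z \<and> g z \<le> l + 1 / real (Suc n)}" for n
    using sets.sets_into_space[OF Z] by (auto simp: A_def)
  then have "A n \<in> sets \<nu>" for n by simp
  moreover have "decseq A"
  proof (rule decseq_SucI)
    fix n
    have "1 / real (Suc (Suc n)) \<le> 1 / real (Suc n)" by (intro divide_left_mono) auto
    then show "A (Suc n) \<subseteq> A n" by (auto simp: A_def)
  qed
  moreover have "(\<Inter>n. A n) = {}"
  proof (rule ccontr)
    assume "(\<Inter>n. A n) \<noteq> {}"
    then obtain z where z: "\<And>n. z \<in> A n" by blast
    then have "0 < g z - l" by (auto simp: A_def)
    then obtain n where "inverse (real (Suc n)) < g z - l" using reals_Archimedean by blast
    then show False using z[of n] by (simp add: A_def field_simps)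
  qed
  ultimately have "(\<lambda>n. measure \<nu> (A n)) \<longlonglongrightarrow> measure \<nu> {}"
    using finite_Lim_measure_decseq[of A] by (metis image_subsetI)
  then show ?thesis by (simp add: A_def)
qed

section \<open>Position reached by a particle that starts at 0\<close>

context transport
begin

text \<open>On \<open>{0..T}\<close> this is the integral of \<open>vel\<close> over
  \<open>{0..t}\<close>. Written with the tail integral it inherits continuity and the Lipschitz
  bound on the whole line.\<close>

definition pos :: "real \<Rightarrow> real" where
  "pos t = integral {0..T} vel - integral {t..T} vel"

lemma pos_0: "pos 0 = 0"
  by (simp add: pos_def)

lemma pos_diff:
  assumes "s \<le> t" "t \<le> T"
  shows "pos t - pos s = integral {s..t} vel"
  using Henstock_Kurzweil_Integration.integral_combine[OF assms vel_integrable_on] by (simp add: pos_def)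

lemma pos_lipschitz: "1-lipschitz_on U pos"
proof -
  have "1-lipschitz_on U (\<lambda>t. integral {t..T} vel)"
    by (intro tail_integral_lipschitz vel_integrable_on vel_le_1 less_imp_le[OF vel_pos])
  then show ?thesis by (simp add: lipschitz_on_def pos_def dist_real_def abs_minus_commute)
qed

lemma pos_continuous: "continuous_on U pos"
  using pos_lipschitz by (rule lipschitz_on_continuous_on)

lemma pos_measurable: "pos \<in> borel_measurable borel"
  by (rule borel_measurable_continuous_onI[OF pos_continuous])

lemma pos_diff_le: "s \<le> t \<Longrightarrow> pos t - pos s \<le> t - s"
  using lipschitz_onD[OF pos_lipschitz, of t UNIV s] by (simp add: dist_real_def abs_le_iff)

lemma pos_mono: "s \<le> t \<Longrightarrow> t \<le> T \<Longrightarrow> pos s \<le> pos t"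
  using pos_diff[of s t] integral_nonneg[OF vel_integrable_on[of s t]] vel_pos
  by (simp add: less_imp_le)

lemma measure_formula_pos:
  assumes "\<tau> \<in> {0..T}" "b \<le> 1"
  shows "measure (\<rho> \<tau>) {0..<b} = measure \<mu> {t \<in> {0<..\<tau>}. pos \<tau> - pos t < b}
    + measure \<rho>0 {x \<in> {0..<1}. x + pos \<tau> < b}"
proof -
  have "{t \<in> {0<..\<tau>}. integral {t..\<tau>} vel < b} = {t \<in> {0<..\<tau>}. pos \<tau> - pos t < b}"
    using pos_diff assms by auto
  moreover have "integral {0..\<tau>} vel = pos \<tau>" using pos_diff[of 0 \<tau>] assms pos_0 by simp
  ultimately show ?thesis using measure_formula[OF assms] by simp
qed

text \<open>A bound on the mass that is uniform in time; as \<alpha> is decreasing and positive, it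
  keeps the speed away from 0.\<close>

lemma mass_le:
  assumes "\<tau> \<in> {0..T}"
  shows "mass \<rho> \<tau> \<le> measure \<mu> {0<..T} + measure \<rho>0 {0..<1}"
proof -
  interpret M: finite_measure \<mu> using finite_borel_measuresD(1)[OF boundary] .
  interpret R: finite_measure \<rho>0 using finite_borel_measuresD(1)[OF initial] .
  have "measure \<mu> {t \<in> {0<..\<tau>}. pos \<tau> - pos t < 1} \<le> measure \<mu> {0<..T}"
    using M.bounded_measure finite_borel_measuresD(3)[OF boundary] by metis
  moreover have "measure \<rho>0 {x \<in> {0..<1}. x + pos \<tau> < 1} \<le> measure \<rho>0 {0..<1}"
    using R.bounded_measure finite_borel_measuresD(3)[OF initial] by metis
  ultimately show ?thesis unfolding mass_def measure_formula_pos[OF assms order_refl] by simp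
qed

end

section \<open>Uniqueness of the position and of the solution\<close>

locale two_solutions = S1: transport T \<alpha> \<rho>0 \<mu> \<rho> + S2: transport T \<alpha> \<rho>0 \<mu> \<rho>'
  for T \<alpha> \<rho>0 \<mu> \<rho> \<rho>' +
  fixes L :: real
  assumes alpha_antimono: "\<And>x y. 0 \<le> x \<Longrightarrow> x \<le> y \<Longrightarrow> \<alpha> y \<le> \<alpha> x"
    and alpha_lipschitz: "L-lipschitz_on {0..} \<alpha>"
begin

text \<open>A particle with exit position \<open>u\<close> is still inside exactly while the current
  position is below \<open>u\<close>. If \<open>u\<close> is common to both solutions,
  \<open>gap s u\<close> says that at time \<open>s\<close> the particle is inside in exactly one of
  them.\<close>

abbreviation gap :: "real \<Rightarrow> real \<Rightarrow> bool" where
  "gap s u \<equiv> min (S1.pos s) (S2.pos s) < u \<and> u \<le> max (S1.pos s) (S2.pos s)"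

text \<open>A particle that has left the unit interval in one solution at time \<open>s < p + 1\<close> but not in the
  other one entered before \<open>p\<close>, because the speeds are at most 1. So the two solutions agree at its
  entrance time, and its exit position lies between the two current positions.\<close>

lemma mass_diff_le:
  assumes eq: "\<And>t. t \<in> {0..p} \<Longrightarrow> S1.pos t = S2.pos t"
    and s: "p \<le> s" "s < p + 1" "s \<in> {0..T}" and p: "0 \<le> p"
  shows "\<bar>mass \<rho> s - mass \<rho>' s\<bar> \<le> measure \<mu> {t \<in> {0<..p}. gap s (S1.pos t + 1)}
    + measure \<rho>0 {x \<in> {0..<1}. gap s (1 - x)}"
proof -
  interpret M: finite_measure \<mu> using finite_borel_measuresD(1)[OF S1.boundary] .
  interpret R: finite_measure \<rho>0 using finite_borel_measuresD(1)[OF S1.initial] .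
  note [measurable] = S1.pos_measurable S2.pos_measurable
  have borel: "{x \<in> I. P x} \<in> sets borel" if "I \<in> sets borel" "Measurable.pred borel P"
    for I and P :: "real \<Rightarrow> bool"
  proof -
    have "{x \<in> I. P x} = I \<inter> {x \<in> space borel. P x}" by auto
    also have "\<dots> \<in> sets borel" using that by measurable
    finally show ?thesis .
  qed
  have "\<bar>measure \<mu> {t \<in> {0<..s}. S1.pos s - S1.pos t < 1} - measure \<mu> {t \<in> {0<..s}. S2.pos s - S2.pos t < 1}\<bar>
      \<le> measure \<mu> {t \<in> {0<..p}. gap s (S1.pos t + 1)}"
  proof (rule M.measure_symmetric_difference_le)
    show "{t \<in> {0<..s}. S1.pos s - S1.pos t < 1} \<in> sets \<mu>"
      "{t \<in> {0<..s}. S2.pos s - S2.pos t < 1} \<in> sets \<mu>"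
      "{t \<in> {0<..p}. gap s (S1.pos t + 1)} \<in> sets \<mu>"
      using s by (intro finite_borel_measures_setsI[OF S1.boundary] borel; auto)+
    have early: "t \<le> p" if "1 \<le> S1.pos s - S1.pos t \<or> 1 \<le> S2.pos s - S2.pos t" "t \<le> s" for t
      using that s(2) S1.pos_diff_le[of t s] S2.pos_diff_le[of t s] by auto
    show "{t \<in> {0<..s}. S1.pos s - S1.pos t < 1} - {t \<in> {0<..s}. S2.pos s - S2.pos t < 1}
        \<subseteq> {t \<in> {0<..p}. gap s (S1.pos t + 1)}"
    proof
      fix t assume "t \<in> {t \<in> {0<..s}. S1.pos s - S1.pos t < 1} - {t \<in> {0<..s}. S2.pos s - S2.pos t < 1}"
      then have t: "0 < t" "t \<le> s" "S1.pos s - S1.pos t < 1" "1 \<le> S2.pos s - S2.pos t" by auto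
      then have "t \<le> p" using early by blast
      then show "t \<in> {t \<in> {0<..p}. gap s (S1.pos t + 1)}" using t eq[of t] by auto
    qed
    show "{t \<in> {0<..s}. S2.pos s - S2.pos t < 1} - {t \<in> {0<..s}. S1.pos s - S1.pos t < 1}
        \<subseteq> {t \<in> {0<..p}. gap s (S1.pos t + 1)}"
    proof
      fix t assume "t \<in> {t \<in> {0<..s}. S2.pos s - S2.pos t < 1} - {t \<in> {0<..s}. S1.pos s - S1.pos t < 1}"
      then have t: "0 < t" "t \<le> s" "S2.pos s - S2.pos t < 1" "1 \<le> S1.pos s - S1.pos t" by auto
      then have "t \<le> p" using early by blast
      then show "t \<in> {t \<in> {0<..p}. gap s (S1.pos t + 1)}" using t eq[of t] by auto
    qed
  qed
  \<comment> \<open>An initial particle starts at the same \<open>x\<close> in both solutions and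
    hence has the common exit position \<open>1 - x\<close>.\<close>
  moreover have "\<bar>measure \<rho>0 {x \<in> {0..<1}. x + S1.pos s < 1} - measure \<rho>0 {x \<in> {0..<1}. x + S2.pos s < 1}\<bar>
      \<le> measure \<rho>0 {x \<in> {0..<1}. gap s (1 - x)}"
  proof (rule R.measure_symmetric_difference_le)
    show "{x \<in> {0..<1}. x + S1.pos s < 1} \<in> sets \<rho>0" "{x \<in> {0..<1}. x + S2.pos s < 1} \<in> sets \<rho>0"
      "{x \<in> {0..<1}. gap s (1 - x)} \<in> sets \<rho>0"
      by (intro finite_borel_measures_setsI[OF S1.initial] borel; auto)+
  qed auto
  ultimately show ?thesis
    unfolding mass_def S1.measure_formula_pos[OF s(3) order_refl] S2.measure_formula_pos[OF s(3) order_refl]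
    by linarith
qed

text \<open>The largest distance \<open>D\<close> of the two positions on a short interval after
  \<open>p\<close> satisfies \<open>D \<le> \<theta> * D\<close> with a factor \<theta> below 1, and
  therefore vanishes.\<close>

lemma local_uniqueness:
  assumes p: "0 \<le> p" "p < T" and eq: "\<And>t. t \<in> {0..p} \<Longrightarrow> S1.pos t = S2.pos t"
  obtains q where "p < q" "q \<le> T" "\<And>t. t \<in> {0..q} \<Longrightarrow> S1.pos t = S2.pos t"
proof -
  interpret M: finite_measure \<mu> using finite_borel_measuresD(1)[OF S1.boundary] .
  interpret R: finite_measure \<rho>0 using finite_borel_measuresD(1)[OF S1.initial] .
  have L: "0 \<le> L" using alpha_lipschitz by (rule lipschitz_on_nonneg)
  \<comment> \<open>The largest mass that can be present gives the smallest speed.\<close>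
  define c where "c = \<alpha> (measure \<mu> {0<..T} + measure \<rho>0 {0..<1})"
  have c: "0 < c" using S1.alpha_range by (auto simp: c_def Pi_iff)
  have vel_ge: "c \<le> S1.vel t" if "t \<in> {0..T}" for t
    unfolding c_def S1.vel_eq[OF that] by (intro alpha_antimono S1.mass_nonneg S1.mass_le that)
  \<comment> \<open>The masses of the boundary particles entered by time \<open>p\<close> and of the
    initial particles whose exit positions lie above \<open>S1.pos p\<close> by at most
    \<open>h\<close>.\<close>
  let ?m = "\<lambda>h. measure \<mu> {t \<in> {0<..p}. S1.pos p < S1.pos t + 1 \<and> S1.pos t + 1 \<le> S1.pos p + h}"
  let ?r = "\<lambda>h. measure \<rho>0 {x \<in> {0..<1}. S1.pos p < 1 - x \<and> 1 - x \<le> S1.pos p + h}"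
  have entry_meas: "(\<lambda>t. S1.pos t + 1) \<in> borel_measurable \<mu>"
    by (intro finite_borel_measures_measurable[OF S1.boundary] borel_measurable_add
        S1.pos_measurable borel_measurable_const)
  have start_meas: "(\<lambda>x. 1 - x) \<in> borel_measurable \<rho>0"
    by (intro finite_borel_measures_measurable[OF S1.initial]) simp
  have sets: "{0<..p} \<in> sets \<mu>" "{0..<1} \<in> sets \<rho>0"
  proof -
    have "{0<..p} \<subseteq> {0<..T}" using p by auto
    then show "{0<..p} \<in> sets \<mu>" by (intro finite_borel_measures_setsI[OF S1.boundary]) simp
    show "{0..<1} \<in> sets \<rho>0" by (intro finite_borel_measures_setsI[OF S1.initial]) simp_all
  qed
  have "(\<lambda>n. 2 * L / c * (?m (1 / real (Suc n)) + ?r (1 / real (Suc n)))) \<longlonglongrightarrow> 2 * L / c * (0 + 0)"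
    by (intro tendsto_intros measure_right_gap_tendsto_0 M.finite_measure_axioms
        R.finite_measure_axioms entry_meas start_meas sets)
  then have "\<forall>\<^sub>F n in sequentially. 2 * L / c * (?m (1 / real (Suc n)) + ?r (1 / real (Suc n))) < 1"
    by (rule order_tendstoD) simp
  \<comment> \<open>Requiring \<open>1 \<le> n\<close> makes \<open>h < 1\<close>, so that
    \<open>mass_diff_le\<close> applies on all of \<open>{p..q}\<close>.\<close>
  from eventually_happens'[OF sequentially_bot eventually_conj[OF this eventually_ge_at_top[of 1]]]
  obtain n where n: "2 * L / c * (?m (1 / real (Suc n)) + ?r (1 / real (Suc n))) < 1" "1 \<le> n"
    by blast
  define h where "h = 1 / real (Suc n)"
  have h: "0 < h" "h < 1" using n(2) by (auto simp: h_def)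
  have small: "2 * L / c * (?m h + ?r h) < 1" using n(1) by (simp only: h_def)
  define q where "q = min T (p + h)"
  have q: "p < q" "q \<le> T" "q \<le> p + h" using p h by (auto simp: q_def)
  have cont: "continuous_on {p..q} (\<lambda>s. \<bar>S1.pos s - S2.pos s\<bar>)"
    by (intro continuous_intros S1.pos_continuous S2.pos_continuous)
  have "{p..q} \<noteq> {}" using q by simp
  from continuous_attains_sup[OF compact_Icc this cont] obtain u where u: "u \<in> {p..q}"
    and max: "\<And>s. s \<in> {p..q} \<Longrightarrow> \<bar>S1.pos s - S2.pos s\<bar> \<le> \<bar>S1.pos u - S2.pos u\<bar>"
    by blast
  define D where "D = \<bar>S1.pos u - S2.pos u\<bar>"
  have D: "0 \<le> D" by (simp add: D_def)
  have eq_p: "S1.pos p = S2.pos p" using eq p by simp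
  have expanding: "c * (t - s) \<le> S1.pos t - S1.pos s" if "p \<le> s" "s \<le> t" "t \<le> q" for s t
  proof -
    have "integral {s..t} (\<lambda>_. c) \<le> integral {s..t} S1.vel"
      using that p q vel_ge by (intro integral_le S1.vel_integrable_on integrable_const_ivl) auto
    then show ?thesis using S1.pos_diff[of s t] that q by (simp add: mult.commute)
  qed
  have range: "S1.pos s \<in> {S1.pos p..S1.pos p + h} \<and> S2.pos s \<in> {S1.pos p..S1.pos p + h}"
    if "s \<in> {p..q}" for s
    using that q S1.pos_mono[of p s] S2.pos_mono[of p s] S1.pos_diff_le[of p s] S2.pos_diff_le[of p s] eq_p
    by auto
  define f where "f = (\<lambda>s. \<bar>S1.vel s - S2.vel s\<bar>)"
  have f_bound: "\<bar>f s\<bar> \<le> 1" for s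
    using S1.vel_pos[of s] S1.vel_le_1[of s] S2.vel_pos[of s] S2.vel_le_1[of s] by (auto simp: f_def)
  have f_int: "f integrable_on {a..b}" for a b
  proof (rule bounded_measurable_integrable_on[OF _ f_bound])
    show "f \<in> borel_measurable lebesgue"
      unfolding f_def by (intro borel_measurable_abs borel_measurable_diff S1.vel_measurable S2.vel_measurable)
  qed
  \<comment> \<open>The positions agree at \<open>p\<close>, so their difference at the maximising
    time \<open>u\<close> is the integral of the speed difference since \<open>p\<close>.\<close>
  have "D \<le> integral {p..q} f"
  proof -
    have "S1.pos u - S2.pos u = (S1.pos u - S1.pos p) - (S2.pos u - S2.pos p)" using eq_p by simp
    also have "\<dots> = integral {p..u} (\<lambda>s. S1.vel s - S2.vel s)"
      using u q S1.pos_diff[of p u] S2.pos_diff[of p u]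
      by (simp add: Henstock_Kurzweil_Integration.integral_diff S1.vel_integrable_on S2.vel_integrable_on)
    also have "\<bar>\<dots>\<bar> \<le> integral {p..u} f"
      using Henstock_Kurzweil_Integration.integral_norm_bound_integral[OF
          integrable_diff[OF S1.vel_integrable_on S2.vel_integrable_on] f_int, of p u]
      by (simp add: f_def)
    also have "\<dots> \<le> integral {p..q} f"
      using u by (intro integral_subset_le f_int) (auto simp: f_def)
    finally show ?thesis by (simp add: D_def)
  qed
  \<comment> \<open>The Lipschitz constant of \<alpha> turns the speed difference into the mass
    between the two positions. Its time integral is at most \<open>2 * D / c\<close> times the mass
    with exit position in the window, by \<open>nn_integral_separated_levels_le\<close>.\<close>
  moreover have "integral {p..q} f \<le> 2 * L / c * (?m h + ?r h) * D"
  proof -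
    let ?G = "\<lambda>s. indicator {p..q} s * emeasure \<mu> {t \<in> {0<..p}. gap s (S1.pos t + 1)}"
    let ?H = "\<lambda>s. indicator {p..q} s * emeasure \<rho>0 {x \<in> {0..<1}. gap s (1 - x)}"
    have G: "?G \<in> borel_measurable lborel" "(\<integral>\<^sup>+s. ?G s \<partial>lborel) \<le> ennreal (2 * D / c) * ennreal (?m h)"
      unfolding M.emeasure_eq_measure[symmetric]
      by (rule nn_integral_separated_levels_le[OF M.finite_measure_axioms entry_meas sets(1)
            S1.pos_measurable S2.pos_measurable c expanding max[folded D_def] range]; assumption)+
    have H: "?H \<in> borel_measurable lborel" "(\<integral>\<^sup>+s. ?H s \<partial>lborel) \<le> ennreal (2 * D / c) * ennreal (?r h)"
      unfolding R.emeasure_eq_measure[symmetric]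
      by (rule nn_integral_separated_levels_le[OF R.finite_measure_axioms start_meas sets(2)
            S1.pos_measurable S2.pos_measurable c expanding max[folded D_def] range]; assumption)+
    have "ennreal (integral {p..q} f) = (\<integral>\<^sup>+s. ennreal (indicator {p..q} s * f s) \<partial>lborel)"
      by (rule nn_integral_has_integral_lebesgue[symmetric])
        (use f_int in \<open>auto simp: f_def intro: integrable_integral\<close>)
    also have "\<dots> \<le> (\<integral>\<^sup>+s. ennreal L * (?G s + ?H s) \<partial>lborel)"
    proof (rule nn_integral_mono)
      fix s
      show "ennreal (indicator {p..q} s * f s) \<le> ennreal L * (?G s + ?H s)"
      proof (cases "s \<in> {p..q}")
        case True
        then have s: "p \<le> s" "s < p + 1" "s \<in> {0..T}" using p q h by auto
        have "f s \<le> L * \<bar>mass \<rho> s - mass \<rho>' s\<bar>"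
          using lipschitz_onD[OF alpha_lipschitz, of "mass \<rho> s" "mass \<rho>' s"]
          unfolding f_def S1.vel_eq[OF s(3)] S2.vel_eq[OF s(3)]
          by (simp add: dist_real_def S1.mass_nonneg S2.mass_nonneg)
        also have "\<dots> \<le> L * (measure \<mu> {t \<in> {0<..p}. gap s (S1.pos t + 1)}
            + measure \<rho>0 {x \<in> {0..<1}. gap s (1 - x)})"
          by (intro mult_left_mono mass_diff_le eq s p L)
        finally show ?thesis
          using True L by (simp add: M.emeasure_eq_measure R.emeasure_eq_measure
              flip: ennreal_plus ennreal_mult)
      qed simp
    qed
    also have "\<dots> = ennreal L * (\<integral>\<^sup>+s. ?G s + ?H s \<partial>lborel)"
      by (intro nn_integral_cmult borel_measurable_add G(1) H(1))
    also have "(\<integral>\<^sup>+s. ?G s + ?H s \<partial>lborel) = (\<integral>\<^sup>+s. ?G s \<partial>lborel) + (\<integral>\<^sup>+s. ?H s \<partial>lborel)"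
      by (intro nn_integral_add G(1) H(1))
    also have "ennreal L * \<dots> \<le> ennreal L * (ennreal (2 * D / c) * ennreal (?m h) + ennreal (2 * D / c) * ennreal (?r h))"
      by (intro mult_left_mono add_mono G(2) H(2)) simp
    also have "\<dots> = ennreal (2 * L / c * (?m h + ?r h) * D)"
      using L D c by (simp add: algebra_simps add_divide_distrib flip: ennreal_plus ennreal_mult)
    finally show ?thesis using L D c by (simp add: ennreal_le_iff)
  qed
  ultimately have "D \<le> 2 * L / c * (?m h + ?r h) * D" by linarith
  \<comment> \<open>A positive \<open>D\<close> would give \<open>D < D\<close>, since the factor is
    below 1.\<close>
  then have "D = 0"
    using small D mult_strict_right_mono[OF small, of D] by (cases "D = 0") auto
  then have "S1.pos t = S2.pos t" if "t \<in> {0..q}" for t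
    using that eq[of t] max[of t] by (cases "t \<le> p") (auto simp: D_def)
  then show thesis using that q by blast
qed

text \<open>Continuation argument: agreement up to all times before the supremum \<open>p\<close> of
  \<open>E\<close> passes to \<open>p\<close> by continuity, and \<open>local_uniqueness\<close>
  would push it further if \<open>p < T\<close>.\<close>

lemma pos_unique:
  assumes "t \<in> {0..T}"
  shows "S1.pos t = S2.pos t"
proof -
  define E where "E = {t \<in> {0..T}. \<forall>s\<in>{0..t}. S1.pos s = S2.pos s}"
  have E: "0 \<in> E" using S1.T_pos S1.pos_0 S2.pos_0 by (auto simp: E_def)
  have bdd: "bdd_above E" by (rule bdd_aboveI[of _ T]) (auto simp: E_def)
  define p where "p = Sup E"
  have "0 \<le> p" unfolding p_def using E bdd by (rule cSup_upper)
  moreover have "p \<le> T" unfolding p_def using E by (intro cSup_least) (auto simp: E_def)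
  ultimately have p: "0 \<le> p" "p \<le> T" .
  have "closed {t. S1.pos t = S2.pos t}"
    by (intro closed_Collect_eq S1.pos_continuous S2.pos_continuous)
  moreover have "E \<subseteq> {t. S1.pos t = S2.pos t}" by (auto simp: E_def)
  ultimately have "closure E \<subseteq> {t. S1.pos t = S2.pos t}" by (rule closure_minimal[rotated])
  moreover have "p \<in> closure E" unfolding p_def using E bdd by (intro closure_contains_Sup) auto
  ultimately have eq_p: "S1.pos p = S2.pos p" by auto
  have eq: "S1.pos s = S2.pos s" if "s \<in> {0..p}" for s
  proof (cases "s = p")
    case False
    then have "s < Sup E" using that by (simp add: p_def)
    then obtain e where "e \<in> E" "s < e" using less_cSupD[of E s] E by blast
    then show ?thesis using that by (auto simp: E_def)
  qed (simp add: eq_p)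
  have "p = T"
  proof (rule ccontr)
    assume "p \<noteq> T"
    then obtain q where "p < q" "q \<le> T" "\<And>t. t \<in> {0..q} \<Longrightarrow> S1.pos t = S2.pos t"
      using local_uniqueness[of p] p eq by (metis less_le)
    then have "q \<in> E" using p by (auto simp: E_def)
    then have "q \<le> p" unfolding p_def using bdd by (rule cSup_upper)
    with \<open>p < q\<close> show False by simp
  qed
  then show ?thesis using eq assms by simp
qed

text \<open>Equal positions make the right-hand sides of \<open>measure_formula_pos\<close> equal,
  and initial segments determine a finite measure on \<open>{0..<1}\<close>.\<close>

lemma unique:
  assumes t: "t \<in> {0..T}"
  shows "\<rho> t = \<rho>' t"
proof (rule finite_borel_measures_eqI[OF S1.rho[OF t] S2.rho[OF t]])
  fix b :: real assume b: "b \<le> 1"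
  have "{s \<in> {0<..t}. S1.pos t - S1.pos s < b} = {s \<in> {0<..t}. S2.pos t - S2.pos s < b}"
    using pos_unique t by auto
  then show "measure (\<rho> t) {0..<b} = measure (\<rho>' t) {0..<b}"
    using S1.measure_formula_pos[OF t b] S2.measure_formula_pos[OF t b] pos_unique[OF t] by simp
qed

end

theorem theorem4p4:
  fixes T :: real and \<alpha> :: "real \<Rightarrow> real"
    and \<rho>0 \<mu> :: "real measure" and \<rho> \<rho>' :: "real \<Rightarrow> real measure"
  assumes "T > 0"
    and "\<alpha> \<in> {0..} \<rightarrow> {0<..1}"
    and "strict_antimono_on {0..} \<alpha>"
    and "\<exists>L. L-lipschitz_on {0..} \<alpha>"
    and "\<alpha> 0 = 1"
    and "\<rho>0 \<in> finite_borel_measures {0..<1}"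
    and "\<mu> \<in> finite_borel_measures {0<..T}"
    and "zero_singular_continuous_part {0..<1} \<rho>0"
    and "zero_singular_continuous_part {0<..T} \<mu>"
    and "weak_solution T \<alpha> \<rho>0 \<mu> \<rho>"
    and "weak_solution T \<alpha> \<rho>0 \<mu> \<rho>'"
  shows "\<forall>t\<in>{0..T}. \<rho> t = \<rho>' t"
proof -
  obtain L where L: "L-lipschitz_on {0..} \<alpha>" using assms(4) by blast
  have "\<alpha> y \<le> \<alpha> x" if "0 \<le> x" "x \<le> y" for x y
    using assms(3) that by (cases "x = y") (auto simp: monotone_on_def less_le)
  then interpret two_solutions T \<alpha> \<rho>0 \<mu> \<rho> \<rho>' L
    using assms L lipschitz_on_continuous_on[OF L] by unfold_locales auto
  show ?thesis using unique by blast
qed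

end
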